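(* Let $(M,g)$ be an $m$-dimensional Riemannian manifold, let $(N,h)$ be a Riemannian manifold with constant sectional curvature $K\neq 0$, and let $\phi:(M,g)\to(N,h)$ be a biharmonic isometric immersion. Let $s\geq 1$ be an integer. If $\phi$ is $(2s+1)$-harmonic, then $\phi$ is harmonic.
   Context: All manifolds and maps are smooth. Let $\phi:(M,g)\to(N,h)$ be smooth, $m=\dim M$. Denote by $\nabla$, $\nabla^N$ the Levi-Civita connections of $M$, $N$, by $\overline\nabla$ the induced connection on the pull-back bundle $\phi^{-1}TN$, and by $\langle\cdot,\cdot\rangle$ the metric $h$. Let $\{e_i\}_{i=1}^m$ be a local orthonormal frame field on $M$. Tension field: $\tau(\phi)=\sum_{i=1}^m\big(\overline\nabla_{e_i}d\phi(e_i)-d\phi(\nabla_{e_i}e_i)\big)\in\Gamma(\phi^{-1}TN)$. The map $\phi$ is harmonic if $\tau(\phi)=0$. Rough Laplacian on sections of $\phi^{-1}TN$: $\overline\triangle=-\sum_{i=1}^m(\overline\nabla_{e_i}\overline\nabla_{e_i}-\overline\nabla_{\nabla_{e_i}e_i})$; $\overline\triangle^0$ is the identity. Curvature convention: $R^N(X,Y)=\nabla^N_X\nabla^N_Y-\nabla^N_Y\nabla^N_X-\nabla^N_{[X,Y]}$, so that for constant sectional curvature $K$ one has $R^N(X,Y)Z=K(\langle Y,Z\rangle X-\langle X,Z\rangle Y)$. The map $\phi$ is biharmonic (2-harmonic) if $\overline\triangle\tau(\phi)-\sum_{i=1}^m R^N(\tau(\phi),d\phi(e_i))d\phi(e_i)=0$.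 A $k$-harmonic map is a critical point of the $k$-energy $E_k(\phi)=\frac12\int_M\|(d+d^* )^k\phi\|^2v_g$. For $k=2s+1$ with $s\ge 1$ this is expressed by the Euler–Lagrange equation: $\phi$ is $(2s+1)$-harmonic if and only if $\tau_{2s+1}(\phi)=0$, where $$\tau_{2s+1}(\phi)=\overline\triangle^{2s}\tau(\phi)-\sum_{j=1}^m R^N(\overline\triangle^{2s-1}\tau(\phi),d\phi(e_j))d\phi(e_j)-\sum_{l=1}^{s-1}\sum_{j=1}^m\Big\{R^N(\overline\nabla_{e_j}\overline\triangle^{s+l-1}\tau(\phi),\overline\triangle^{s-l-1}\tau(\phi))d\phi(e_j)-R^N(\overline\triangle^{s+l-1}\tau(\phi),\overline\nabla_{e_j}\overline\triangle^{s-l-1}\tau(\phi))d\phi(e_j)\Big\}-\sum_{i=1}^m R^N(\overline\nabla_{e_i}\overline\triangle^{s-1}\tau(\phi),\overline\triangle^{s-1}\tau(\phi))d\phi(e_i).$$ *)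

theory Defs
  imports "HOL-Analysis.Analysis"
begin

section \<open>Smooth manifolds and Riemannian metrics\<close>

text \<open>
  \<open>C^k\<close> maps between Euclidean spaces; the recursion over directional derivatives gives the usual
  notion when \<open>S\<close> is open, which is the only case used below.
\<close>

abbreviation fderiv :: "('a::real_normed_vector \<Rightarrow> 'b::real_normed_vector) \<Rightarrow> 'a \<Rightarrow> 'a \<Rightarrow> 'b" where
  "fderiv f x \<equiv> frechet_derivative f (at x)"

primrec Ck_on :: "nat \<Rightarrow> 'a::euclidean_space set \<Rightarrow> ('a \<Rightarrow> 'b::real_normed_vector) \<Rightarrow> bool" where
  "Ck_on 0 S f \<longleftrightarrow> continuous_on S f"
| "Ck_on (Suc k) S f \<longleftrightarrow> (\<forall>x\<in>S. f differentiable at x) \<and> (\<forall>v. Ck_on k S (\<lambda>x. fderiv f x v))"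

definition smooth_on :: "'a::euclidean_space set \<Rightarrow> ('a \<Rightarrow> 'b::real_normed_vector) \<Rightarrow> bool" where
  "smooth_on S f \<longleftrightarrow> (\<forall>k. Ck_on k S f)"

text \<open>
  A chart is a pair \<open>(U, \<xi>)\<close> of a coordinate domain and a coordinate map into the model space \<open>'e\<close>;
  the dimension of the manifold is \<open>DIM('e)\<close>.  The metric is given by its representation in each
  chart of the atlas: \<open>metric M c y\<close> is a bilinear form on \<open>'e\<close>, where \<open>y\<close> ranges over the
  coordinate image of \<open>c\<close>.
\<close>

type_synonym ('p, 'e) chart = "'p set \<times> ('p \<Rightarrow> 'e)"

record ('p, 'e) riemannian =
  base :: "'p topology"
  atlas :: "('p, 'e) chart set"
  metric :: "('p, 'e) chart \<Rightarrow> 'e \<Rightarrow> 'e \<Rightarrow> 'e \<Rightarrow> real"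

definition coord_image :: "('p, 'e) chart \<Rightarrow> 'e set" where
  "coord_image c = snd c ` fst c"

definition chart_inv :: "('p, 'e) chart \<Rightarrow> 'e \<Rightarrow> 'p" where
  "chart_inv c = inv_into (fst c) (snd c)"

definition chart_on :: "'p topology \<Rightarrow> ('p, 'e::euclidean_space) chart \<Rightarrow> bool" where
  "chart_on X c \<longleftrightarrow>
     openin X (fst c) \<and> open (coord_image c) \<and>
     homeomorphic_map (subtopology X (fst c)) (top_of_set (coord_image c)) (snd c)"

definition transition :: "('p, 'e) chart \<Rightarrow> ('p, 'e) chart \<Rightarrow> 'e \<Rightarrow> 'e" where
  "transition c c' = snd c' \<circ> chart_inv c"

definition smooth_manifold :: "('p, 'e::euclidean_space, 'z) riemannian_scheme \<Rightarrow> bool" where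
  "smooth_manifold M \<longleftrightarrow>
     Hausdorff_space (base M) \<and> second_countable (base M) \<and>
     (\<forall>c\<in>atlas M. chart_on (base M) c) \<and>
     (\<Union>c\<in>atlas M. fst c) = topspace (base M) \<and>
     (\<forall>c\<in>atlas M. \<forall>c'\<in>atlas M. smooth_on (snd c ` (fst c \<inter> fst c')) (transition c c'))"

definition local_metric :: "'e::euclidean_space set \<Rightarrow> ('e \<Rightarrow> 'e \<Rightarrow> 'e \<Rightarrow> real) \<Rightarrow> bool" where
  "local_metric S G \<longleftrightarrow>
     (\<forall>u v. smooth_on S (\<lambda>y. G y u v)) \<and>
     (\<forall>y\<in>S. bilinear (G y) \<and> (\<forall>u v. G y u v = G y v u) \<and> (\<forall>u. u \<noteq> 0 \<longrightarrow> G y u u > 0))"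

definition riemannian_manifold :: "('p, 'e::euclidean_space, 'z) riemannian_scheme \<Rightarrow> bool" where
  "riemannian_manifold M \<longleftrightarrow>
     smooth_manifold M \<and>
     (\<forall>c\<in>atlas M. local_metric (coord_image c) (metric M c)) \<and>
     (\<forall>c\<in>atlas M. \<forall>c'\<in>atlas M. \<forall>y\<in>snd c ` (fst c \<inter> fst c'). \<forall>u v.
        metric M c y u v =
          metric M c' (transition c c' y) (fderiv (transition c c') y u) (fderiv (transition c c') y v))"


section \<open>Connections and curvature in a chart\<close>

text \<open>
  The connection form of the Levi-Civita connection of the local metric \<open>G\<close>:
  \<open>christoffel G x u v\<close> is \<open>\<nabla>\<^sub>u v\<close> at \<open>x\<close> for vector fields \<open>u\<close>, \<open>v\<close> that are constant in the chart.
  As such fields commute, symmetry says that \<open>\<nabla>\<close> is torsion-free, and the last clause is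
  \<open>u\<langle>v,w\<rangle> = \<langle>\<nabla>\<^sub>u v, w\<rangle> + \<langle>v, \<nabla>\<^sub>u w\<rangle>\<close>.
\<close>

definition christoffel :: "('e::euclidean_space \<Rightarrow> 'e \<Rightarrow> 'e \<Rightarrow> real) \<Rightarrow> 'e \<Rightarrow> 'e \<Rightarrow> 'e \<Rightarrow> 'e" where
  "christoffel G x = (THE \<Gamma>. bilinear \<Gamma> \<and> (\<forall>u v. \<Gamma> u v = \<Gamma> v u) \<and>
     (\<forall>u v w. fderiv (\<lambda>y. G y v w) x u = G x (\<Gamma> u v) w + G x v (\<Gamma> u w)))"

definition nabla ::
  "('e::euclidean_space \<Rightarrow> 'e \<Rightarrow> 'e \<Rightarrow> real) \<Rightarrow> ('e \<Rightarrow> 'e) \<Rightarrow> ('e \<Rightarrow> 'e) \<Rightarrow> 'e \<Rightarrow> 'e" where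
  "nabla G X Y x = fderiv Y x (X x) + christoffel G x (X x) (Y x)"

definition lie_bracket :: "('e::euclidean_space \<Rightarrow> 'e) \<Rightarrow> ('e \<Rightarrow> 'e) \<Rightarrow> 'e \<Rightarrow> 'e" where
  "lie_bracket X Y x = fderiv Y x (X x) - fderiv X x (Y x)"

definition curvature_op ::
  "('e::euclidean_space \<Rightarrow> 'e \<Rightarrow> 'e \<Rightarrow> real) \<Rightarrow> ('e \<Rightarrow> 'e) \<Rightarrow> ('e \<Rightarrow> 'e) \<Rightarrow> ('e \<Rightarrow> 'e) \<Rightarrow> 'e \<Rightarrow> 'e" where
  "curvature_op G X Y Z x =
     nabla G X (nabla G Y Z) x - nabla G Y (nabla G X Z) x - nabla G (lie_bracket X Y) Z x"

text \<open>
  The value of the curvature tensor on tangent vectors at \<open>x\<close>; being tensorial, it may be computed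
  from the extensions that are constant in the chart.
\<close>

definition curvature ::
  "('e::euclidean_space \<Rightarrow> 'e \<Rightarrow> 'e \<Rightarrow> real) \<Rightarrow> 'e \<Rightarrow> 'e \<Rightarrow> 'e \<Rightarrow> 'e \<Rightarrow> 'e" where
  "curvature G x u v w = curvature_op G (\<lambda>_. u) (\<lambda>_. v) (\<lambda>_. w) x"

definition sectional_curvature ::
  "('e::euclidean_space \<Rightarrow> 'e \<Rightarrow> 'e \<Rightarrow> real) \<Rightarrow> 'e \<Rightarrow> 'e \<Rightarrow> 'e \<Rightarrow> real" where
  "sectional_curvature G x u v =
     G x (curvature G x u v v) u / (G x u u * G x v v - (G x u v)\<^sup>2)"

definition constant_sectional_curvature ::
  "('p, 'e::euclidean_space, 'z) riemannian_scheme \<Rightarrow> real \<Rightarrow> bool" where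
  "constant_sectional_curvature N K \<longleftrightarrow>
     (\<forall>c\<in>atlas N. \<forall>y\<in>coord_image c. \<forall>u v. u \<noteq> v \<and> independent {u, v} \<longrightarrow>
        sectional_curvature (metric N c) y u v = K)"


section \<open>Maps and sections of the pull-back bundle in a pair of charts\<close>

text \<open>
  Below, \<open>F\<close> is the representation of \<open>\<phi>\<close> in a chart of \<open>M\<close> and a chart of \<open>N\<close>, and \<open>G\<close>, \<open>H\<close> are the
  two metrics in these charts.  A section of \<open>\<phi>\<^sup>-\<^sup>1TN\<close> is represented by a function \<open>V\<close> from
  coordinates on \<open>M\<close> to the model space of \<open>N\<close>, with \<open>V x\<close> a tangent vector at \<open>F x\<close>.
\<close>

definition push :: "('e::euclidean_space \<Rightarrow> 'f::euclidean_space) \<Rightarrow> ('e \<Rightarrow> 'e) \<Rightarrow> 'e \<Rightarrow> 'f" where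
  "push F X x = fderiv F x (X x)"

definition nabla_pull ::
  "('f::euclidean_space \<Rightarrow> 'f \<Rightarrow> 'f \<Rightarrow> real) \<Rightarrow> ('e::euclidean_space \<Rightarrow> 'f) \<Rightarrow>
   ('e \<Rightarrow> 'e) \<Rightarrow> ('e \<Rightarrow> 'f) \<Rightarrow> 'e \<Rightarrow> 'f" where
  "nabla_pull H F X V x = fderiv V x (X x) + christoffel H (F x) (push F X x) (V x)"

text \<open>Local frames are indexed by \<open>0, \<dots>, m - 1\<close>, where \<open>m = DIM('e)\<close>.\<close>

definition orthonormal_frame ::
  "('e::euclidean_space \<Rightarrow> 'e \<Rightarrow> 'e \<Rightarrow> real) \<Rightarrow> 'e set \<Rightarrow> (nat \<Rightarrow> 'e \<Rightarrow> 'e) \<Rightarrow> bool" where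
  "orthonormal_frame G W e \<longleftrightarrow>
     (\<forall>i<DIM('e). smooth_on W (e i)) \<and>
     (\<forall>x\<in>W. \<forall>i<DIM('e). \<forall>j<DIM('e). G x (e i x) (e j x) = (if i = j then 1 else 0))"

definition tension ::
  "('e::euclidean_space \<Rightarrow> 'e \<Rightarrow> 'e \<Rightarrow> real) \<Rightarrow> ('f::euclidean_space \<Rightarrow> 'f \<Rightarrow> 'f \<Rightarrow> real) \<Rightarrow>
   ('e \<Rightarrow> 'f) \<Rightarrow> (nat \<Rightarrow> 'e \<Rightarrow> 'e) \<Rightarrow> 'e \<Rightarrow> 'f" where
  "tension G H F e x =
     (\<Sum>i<DIM('e). nabla_pull H F (e i) (push F (e i)) x - push F (nabla G (e i) (e i)) x)"

definition rough_laplacian ::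
  "('e::euclidean_space \<Rightarrow> 'e \<Rightarrow> 'e \<Rightarrow> real) \<Rightarrow> ('f::euclidean_space \<Rightarrow> 'f \<Rightarrow> 'f \<Rightarrow> real) \<Rightarrow>
   ('e \<Rightarrow> 'f) \<Rightarrow> (nat \<Rightarrow> 'e \<Rightarrow> 'e) \<Rightarrow> ('e \<Rightarrow> 'f) \<Rightarrow> 'e \<Rightarrow> 'f" where
  "rough_laplacian G H F e V x =
     - (\<Sum>i<DIM('e). nabla_pull H F (e i) (nabla_pull H F (e i) V) x
                     - nabla_pull H F (nabla G (e i) (e i)) V x)"

definition lap_tension ::
  "('e::euclidean_space \<Rightarrow> 'e \<Rightarrow> 'e \<Rightarrow> real) \<Rightarrow> ('f::euclidean_space \<Rightarrow> 'f \<Rightarrow> 'f \<Rightarrow> real) \<Rightarrow>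
   ('e \<Rightarrow> 'f) \<Rightarrow> (nat \<Rightarrow> 'e \<Rightarrow> 'e) \<Rightarrow> nat \<Rightarrow> 'e \<Rightarrow> 'f" where
  "lap_tension G H F e k = (rough_laplacian G H F e ^^ k) (tension G H F e)"

definition bitension ::
  "('e::euclidean_space \<Rightarrow> 'e \<Rightarrow> 'e \<Rightarrow> real) \<Rightarrow> ('f::euclidean_space \<Rightarrow> 'f \<Rightarrow> 'f \<Rightarrow> real) \<Rightarrow>
   ('e \<Rightarrow> 'f) \<Rightarrow> (nat \<Rightarrow> 'e \<Rightarrow> 'e) \<Rightarrow> 'e \<Rightarrow> 'f" where
  "bitension G H F e x =
     rough_laplacian G H F e (tension G H F e) x
     - (\<Sum>i<DIM('e). curvature H (F x) (tension G H F e x) (push F (e i) x) (push F (e i) x))"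

text \<open>The field \<open>\<tau>\<close> with index \<open>2s + 1\<close>; all the differences of exponents are exact for \<open>s \<ge> 1\<close>.\<close>

definition odd_polytension ::
  "nat \<Rightarrow> ('e::euclidean_space \<Rightarrow> 'e \<Rightarrow> 'e \<Rightarrow> real) \<Rightarrow> ('f::euclidean_space \<Rightarrow> 'f \<Rightarrow> 'f \<Rightarrow> real) \<Rightarrow>
   ('e \<Rightarrow> 'f) \<Rightarrow> (nat \<Rightarrow> 'e \<Rightarrow> 'e) \<Rightarrow> 'e \<Rightarrow> 'f" where
  "odd_polytension s G H F e x =
    (let T = lap_tension G H F e;
         R = curvature H (F x);
         dF = (\<lambda>j. push F (e j) x);
         N = (\<lambda>j. nabla_pull H F (e j))
     in T (2 * s) x
        - (\<Sum>j<DIM('e). R (T (2 * s - 1) x) (dF j) (dF j))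
        - (\<Sum>l = 1..s - 1. \<Sum>j<DIM('e).
             R (N j (T (s + l - 1)) x) (T (s - l - 1) x) (dF j)
             - R (T (s + l - 1) x) (N j (T (s - l - 1)) x) (dF j))
        - (\<Sum>i<DIM('e). R (N i (T (s - 1)) x) (T (s - 1) x) (dF i)))"


section \<open>Harmonic maps and isometric immersions\<close>

definition coord_map ::
  "('p, 'e) chart \<Rightarrow> ('q, 'f) chart \<Rightarrow> ('p \<Rightarrow> 'q) \<Rightarrow> 'e \<Rightarrow> 'f" where
  "coord_map c d \<phi> = snd d \<circ> \<phi> \<circ> chart_inv c"

definition coord_dom ::
  "('p, 'e) chart \<Rightarrow> ('q, 'f) chart \<Rightarrow> ('p \<Rightarrow> 'q) \<Rightarrow> 'e set" where
  "coord_dom c d \<phi> = snd c ` {p \<in> fst c. \<phi> p \<in> fst d}"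

definition smooth_map ::
  "('p, 'e::euclidean_space, 'y) riemannian_scheme \<Rightarrow> ('q, 'f::euclidean_space, 'z) riemannian_scheme \<Rightarrow>
   ('p \<Rightarrow> 'q) \<Rightarrow> bool" where
  "smooth_map M N \<phi> \<longleftrightarrow>
     continuous_map (base M) (base N) \<phi> \<and>
     (\<forall>c\<in>atlas M. \<forall>d\<in>atlas N. smooth_on (coord_dom c d \<phi>) (coord_map c d \<phi>))"

definition isometric_immersion ::
  "('p, 'e::euclidean_space, 'y) riemannian_scheme \<Rightarrow> ('q, 'f::euclidean_space, 'z) riemannian_scheme \<Rightarrow>
   ('p \<Rightarrow> 'q) \<Rightarrow> bool" where
  "isometric_immersion M N \<phi> \<longleftrightarrow>
     smooth_map M N \<phi> \<and>
     (\<forall>c\<in>atlas M. \<forall>d\<in>atlas N. \<forall>x\<in>coord_dom c d \<phi>.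
        inj (fderiv (coord_map c d \<phi>) x) \<and>
        (\<forall>u v. metric M c x u v =
           metric N d (coord_map c d \<phi> x) (fderiv (coord_map c d \<phi>) x u) (fderiv (coord_map c d \<phi>) x v)))"

text \<open>
  A section of \<open>\<phi>\<^sup>-\<^sup>1TN\<close> that is given locally by a formula \<open>T G H F e\<close> in terms of a local
  orthonormal frame \<open>e\<close> vanishes identically.
\<close>

definition vanishes_in_frames ::
  "('p, 'e::euclidean_space, 'y) riemannian_scheme \<Rightarrow> ('q, 'f::euclidean_space, 'z) riemannian_scheme \<Rightarrow>
   ('p \<Rightarrow> 'q) \<Rightarrow>
   (('e \<Rightarrow> 'e \<Rightarrow> 'e \<Rightarrow> real) \<Rightarrow> ('f \<Rightarrow> 'f \<Rightarrow> 'f \<Rightarrow> real) \<Rightarrow> ('e \<Rightarrow> 'f) \<Rightarrow> (nat \<Rightarrow> 'e \<Rightarrow> 'e) \<Rightarrow> 'e \<Rightarrow> 'f) \<Rightarrow>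
   bool" where
  "vanishes_in_frames M N \<phi> T \<longleftrightarrow>
     (\<forall>c\<in>atlas M. \<forall>d\<in>atlas N. \<forall>W e.
        open W \<and> W \<subseteq> coord_dom c d \<phi> \<and> orthonormal_frame (metric M c) W e \<longrightarrow>
        (\<forall>x\<in>W. T (metric M c) (metric N d) (coord_map c d \<phi>) e x = 0))"

definition harmonic ::
  "('p, 'e::euclidean_space, 'y) riemannian_scheme \<Rightarrow> ('q, 'f::euclidean_space, 'z) riemannian_scheme \<Rightarrow>
   ('p \<Rightarrow> 'q) \<Rightarrow> bool" where
  "harmonic M N \<phi> \<longleftrightarrow> vanishes_in_frames M N \<phi> tension"

definition biharmonic ::
  "('p, 'e::euclidean_space, 'y) riemannian_scheme \<Rightarrow> ('q, 'f::euclidean_space, 'z) riemannian_scheme \<Rightarrow>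
   ('p \<Rightarrow> 'q) \<Rightarrow> bool" where
  "biharmonic M N \<phi> \<longleftrightarrow> vanishes_in_frames M N \<phi> bitension"

text \<open>
  The map \<open>\<phi>\<close> is \<open>(2s + 1)\<close>-harmonic, \<open>s \<ge> 1\<close>, in the sense of the Euler--Lagrange equation of the
  \<open>(2s + 1)\<close>-energy; no compactness of \<open>M\<close> is required.
\<close>

definition odd_polyharmonic ::
  "nat \<Rightarrow> ('p, 'e::euclidean_space, 'y) riemannian_scheme \<Rightarrow>
   ('q, 'f::euclidean_space, 'z) riemannian_scheme \<Rightarrow> ('p \<Rightarrow> 'q) \<Rightarrow> bool" where
  "odd_polyharmonic s M N \<phi> \<longleftrightarrow> vanishes_in_frames M N \<phi> (odd_polytension s)"

end

theory Submission
  imports Defs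
begin

text \<open>
  The argument is pointwise once the calculus of the pull-back bundle is available.  The tension
  field \<open>\<tau>\<close> of an isometric immersion \<open>\<phi>\<close> is the trace of its second fundamental form, hence normal
  to the image.  In constant curvature \<open>K\<close> one has \<open>R(X, Y)Z = K(\<langle>Y, Z\<rangle>X - \<langle>X, Z\<rangle>Y)\<close>, so that
  \<open>\<Sum>\<^sub>i R(\<tau>, d\<phi>(e\<^sub>i))d\<phi>(e\<^sub>i) = mK\<tau>\<close>, and biharmonicity says that \<open>\<tau>\<close> is an eigensection of the rough
  Laplacian with eigenvalue \<open>\<kappa> = mK\<close>.  All iterated Laplacians of \<open>\<tau>\<close> are then multiples of \<open>\<tau>\<close>
  (\<open>lap_tension_eq\<close>).

  Differentiating \<open>\<langle>\<tau>, d\<phi>(e\<^sub>i)\<rangle> = 0\<close> gives \<open>\<Sum>\<^sub>i \<langle>\<nabla>\<^sub>i\<tau>, d\<phi>(e\<^sub>i)\<rangle> = -|\<tau>|\<^sup>2\<close>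
  (\<open>sum_cov_tension_tangential\<close>), and inserting everything into the Euler--Lagrange equation the two
  leading terms cancel and what remains is \<open>-(2s - 1) K \<kappa>\<^bsup>2s-2\<^esup> |\<tau>|\<^sup>2 \<tau>\<close>
  (\<open>odd_polytension_eq\<close>).  As \<open>K\<close> and \<open>\<kappa>\<close> are nonzero, \<open>\<tau> = 0\<close>.

  The differential geometry needed for this is developed in charts.  The Levi-Civita connection
  exists, is unique, and depends smoothly on the base point, because its connection form solves a
  linear equation with smooth coefficients (\<open>levi_civita_exists\<close>, \<open>Ck_christoffel\<close>).  The curvature
  tensor has the usual symmetries, and a tensor with these symmetries is determined by its
  sectional curvatures (\<open>curvature_like_eq_zero\<close>, \<open>constant_curvature_eq\<close>).  The metric compatibility
  of the connection on the pull-back bundle is \<open>nabla_pull_metric\<close>.  Smoothness matters throughout,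
  since the covariant derivative of a multiple of \<open>\<tau>\<close> is only the multiple of the covariant
  derivative where \<open>\<tau>\<close> is differentiable.
\<close>

section \<open>Calculus of \<open>C\<^sup>k\<close> maps\<close>

lemma has_derivative_fderiv:
  "f differentiable at x \<Longrightarrow> (f has_derivative fderiv f x) (at x)"
  by (simp add: frechet_derivative_works)

lemma fderiv_eq: "(f has_derivative f') (at x) \<Longrightarrow> fderiv f x v = f' v"
  by (metis frechet_derivative_at)

lemma fderiv_cong_open:
  assumes "open S" "x \<in> S" "\<And>y. y \<in> S \<Longrightarrow> f y = g y" "f differentiable at x"
  shows "fderiv g x = fderiv f x"
  using frechet_derivative_transform_within_open[OF assms(4) assms(1,2), of g] assms(3) by simp

lemma Ck_on_cong:
  assumes "open S" "Ck_on k S f" "\<And>x. x \<in> S \<Longrightarrow> f x = g x"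
  shows "Ck_on k S g"
  using assms(2,3)
proof (induction k arbitrary: f g)
  case 0
  then show ?case using continuous_on_cong[of S S f g] by (metis Ck_on.simps(1))
next
  case (Suc k)
  have d: "g differentiable at x" if "x \<in> S" for x
  proof -
    have "(f has_derivative fderiv f x) (at x)"
      using Suc.prems that by (auto intro: has_derivative_fderiv)
    then have "(g has_derivative fderiv f x) (at x)"
      by (rule has_derivative_transform_within_open[OF _ assms(1) that]) (rule Suc.prems)
    then show ?thesis by (auto simp: differentiable_def)
  qed
  have e: "fderiv g x = fderiv f x" if "x \<in> S" for x
    by (rule fderiv_cong_open[OF assms(1) that]) (use Suc.prems(1) that in \<open>auto intro: Suc.prems(2)\<close>)
  have "Ck_on k S (\<lambda>x. fderiv g x v)" for v
    by (rule Suc.IH[of "\<lambda>x. fderiv f x v"]) (use Suc.prems(1) in \<open>simp_all add: e\<close>)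
  with d show ?case by simp
qed

lemma Ck_on_SucD: "Ck_on (Suc k) S f \<Longrightarrow> Ck_on k S f"
proof (induction k arbitrary: f)
  case 0
  then show ?case
    by (auto intro!: continuous_at_imp_continuous_on differentiable_imp_continuous_within)
qed auto

lemma Ck_on_subset: "Ck_on k T f \<Longrightarrow> S \<subseteq> T \<Longrightarrow> Ck_on k S f"
  by (induction k arbitrary: f) (auto intro: continuous_on_subset)

lemma Ck_on_SucI:
  assumes "open S" "\<And>x. x \<in> S \<Longrightarrow> (f has_derivative f' x) (at x)" "\<And>v. Ck_on k S (\<lambda>x. f' x v)"
  shows "Ck_on (Suc k) S f"
proof -
  have "Ck_on k S (\<lambda>x. fderiv f x v)" for v
    using assms(3) by (rule Ck_on_cong[OF assms(1)]) (use fderiv_eq[OF assms(2)] in simp)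
  then show ?thesis using assms(2) by (auto simp: differentiable_def)
qed

lemma Ck_on_const: "Ck_on k S (\<lambda>x. c)"
  by (induction k arbitrary: c) simp_all

lemma Ck_on_bounded_linear:
  assumes "open S" "bounded_linear L" "Ck_on k S f"
  shows "Ck_on k S (\<lambda>x. L (f x))"
  using assms(3)
proof (induction k arbitrary: f)
  case 0
  then show ?case using bounded_linear.continuous_on[OF assms(2)] by simp
next
  case (Suc k)
  show ?case
  proof (rule Ck_on_SucI[OF assms(1)])
    show "((\<lambda>x. L (f x)) has_derivative (\<lambda>v. L (fderiv f x v))) (at x)" if "x \<in> S" for x
      using Suc.prems that by (intro bounded_linear.has_derivative[OF assms(2)] has_derivative_fderiv) simp
    show "Ck_on k S (\<lambda>x. L (fderiv f x v))" for v
      using Suc.prems by (intro Suc.IH) simp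
  qed
qed

lemma Ck_on_add:
  assumes "open S" "Ck_on k S f" "Ck_on k S g"
  shows "Ck_on k S (\<lambda>x. f x + g x)"
  using assms(2,3)
proof (induction k arbitrary: f g)
  case 0
  then show ?case by (auto intro: continuous_on_add)
next
  case (Suc k)
  show ?case
  proof (rule Ck_on_SucI[OF assms(1)])
    show "((\<lambda>x. f x + g x) has_derivative (\<lambda>v. fderiv f x v + fderiv g x v)) (at x)"
      if "x \<in> S" for x
      using Suc.prems that by (intro has_derivative_add has_derivative_fderiv) simp_all
    show "Ck_on k S (\<lambda>x. fderiv f x v + fderiv g x v)" for v
      using Suc.prems by (intro Suc.IH) simp_all
  qed
qed

lemma Ck_on_sum:
  assumes "open S" "\<And>i. i \<in> I \<Longrightarrow> Ck_on k S (f i)"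
  shows "Ck_on k S (\<lambda>x. \<Sum>i\<in>I. f i x)"
  using assms(2)
proof (induction I rule: infinite_finite_induct)
  case (insert i I)
  then have "Ck_on k S (\<lambda>x. f i x + (\<Sum>i\<in>I. f i x))"
    by (intro Ck_on_add[OF assms(1)]) simp_all
  with insert show ?case by simp
qed (simp_all add: Ck_on_const)

lemma Ck_on_scaleR:
  assumes "open S" "Ck_on k S a" "Ck_on k S f"
  shows "Ck_on k S (\<lambda>x. a x *\<^sub>R f x)"
  using assms(2,3)
proof (induction k arbitrary: a f)
  case 0
  then show ?case by (auto intro: continuous_on_scaleR)
next
  case (Suc k)
  show ?case
  proof (rule Ck_on_SucI[OF assms(1)])
    show "((\<lambda>x. a x *\<^sub>R f x) has_derivative (\<lambda>v. a x *\<^sub>R fderiv f x v + fderiv a x v *\<^sub>R f x)) (at x)"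
      if "x \<in> S" for x
      using Suc.prems that by (intro has_derivative_scaleR has_derivative_fderiv) simp_all
    show "Ck_on k S (\<lambda>x. a x *\<^sub>R fderiv f x v + fderiv a x v *\<^sub>R f x)" for v
    proof (rule Ck_on_add[OF assms(1)])
      show "Ck_on k S (\<lambda>x. a x *\<^sub>R fderiv f x v)"
        using Suc.prems by (intro Suc.IH Ck_on_SucD[OF Suc.prems(1)]) simp
      show "Ck_on k S (\<lambda>x. fderiv a x v *\<^sub>R f x)"
        using Suc.prems by (intro Suc.IH Ck_on_SucD[OF Suc.prems(2)]) simp
    qed
  qed
qed

lemma linear_expand:
  fixes L :: "'a::euclidean_space \<Rightarrow> 'b::real_vector"
  assumes "linear L"
  shows "L u = (\<Sum>b\<in>Basis. (u \<bullet> b) *\<^sub>R L b)"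
proof -
  have "L u = L (\<Sum>b\<in>Basis. (u \<bullet> b) *\<^sub>R b)" by (simp add: euclidean_representation)
  then show ?thesis by (simp add: linear_sum[OF assms] linear_scale[OF assms])
qed

text \<open>
  Evaluating a family of linear maps that is \<open>C\<^sup>k\<close> for each fixed argument; it suffices to expand
  the argument in the standard basis.
\<close>

lemma Ck_on_linear_apply:
  fixes U :: "'a::euclidean_space \<Rightarrow> 'b::euclidean_space"
  assumes "open S" "\<And>x. x \<in> S \<Longrightarrow> linear (L x)" "\<And>u. Ck_on k S (\<lambda>x. L x u)" "Ck_on k S U"
  shows "Ck_on k S (\<lambda>x. L x (U x))"
proof (rule Ck_on_cong[OF assms(1)])
  show "Ck_on k S (\<lambda>x. \<Sum>b\<in>Basis. (U x \<bullet> b) *\<^sub>R L x b)"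
    by (rule Ck_on_sum[OF assms(1) Ck_on_scaleR[OF assms(1)
          Ck_on_bounded_linear[OF assms(1) bounded_linear_inner_left assms(4)] assms(3)]])
  show "(\<Sum>b\<in>Basis. (U x \<bullet> b) *\<^sub>R L x b) = L x (U x)" if "x \<in> S" for x
    using linear_expand[OF assms(2)[OF that], of "U x"] by simp
qed

lemma Ck_on_bilinear_apply:
  fixes U :: "'a::euclidean_space \<Rightarrow> 'b::euclidean_space" and V :: "'a \<Rightarrow> 'c::euclidean_space"
  assumes "open S" "\<And>x. x \<in> S \<Longrightarrow> bilinear (B x)" "\<And>u v. Ck_on k S (\<lambda>x. B x u v)"
    and "Ck_on k S U" "Ck_on k S V"
  shows "Ck_on k S (\<lambda>x. B x (U x) (V x))"
proof -
  have 1: "linear (B x (U x))" if "x \<in> S" for x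
    using assms(2)[OF that] by (simp add: bilinear_def)
  have 2: "linear (\<lambda>u. B x u v)" if "x \<in> S" for x v
    using assms(2)[OF that] by (simp add: bilinear_def)
  have 3: "Ck_on k S (\<lambda>x. B x (U x) v)" for v
    by (rule Ck_on_linear_apply[where L = "\<lambda>x u. B x u v", OF assms(1) 2 assms(3) assms(4)])
  show ?thesis
    by (rule Ck_on_linear_apply[where L = "\<lambda>x. B x (U x)", OF assms(1) 1 3 assms(5)])
qed

lemma Ck_on_compose:
  fixes f :: "'b::euclidean_space \<Rightarrow> 'c::real_normed_vector" and F :: "'a::euclidean_space \<Rightarrow> 'b"
  assumes "open S" "open T" "Ck_on k T f" "Ck_on k S F" "F ` S \<subseteq> T"
  shows "Ck_on k S (\<lambda>x. f (F x))"
  using assms(3,4)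
proof (induction k arbitrary: f)
  case 0
  then show ?case
    using continuous_on_compose2[of T f S F] assms(5) by (simp only: Ck_on.simps)
next
  case (Suc k)
  have df: "f differentiable at (F x)" if "x \<in> S" for x
    using Suc.prems(1) subsetD[OF assms(5) imageI[OF that]] by simp
  show ?case
  proof (rule Ck_on_SucI[OF assms(1)])
    show "((\<lambda>x. f (F x)) has_derivative (\<lambda>v. fderiv f (F x) (fderiv F x v))) (at x)"
      if "x \<in> S" for x
    proof (rule has_derivative_compose[where f = F and g = f])
      show "(F has_derivative fderiv F x) (at x)"
        using Suc.prems(2) that by (intro has_derivative_fderiv) simp
    qed (rule has_derivative_fderiv[OF df[OF that]])
    show "Ck_on k S (\<lambda>x. fderiv f (F x) (fderiv F x v))" for v
    proof (rule Ck_on_linear_apply[where L = "\<lambda>x. fderiv f (F x)", OF assms(1)])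
      show "linear (fderiv f (F x))" if "x \<in> S" for x
        by (rule linear_frechet_derivative[OF df[OF that]])
      show "Ck_on k S (\<lambda>x. fderiv f (F x) u)" for u
        using Suc.prems(1) by (intro Suc.IH[of "\<lambda>y. fderiv f y u"] Ck_on_SucD[OF Suc.prems(2)]) simp
    qed (use Suc.prems(2) in simp)
  qed
qed

text \<open>
  If \<open>f\<close> vanishes at \<open>x\<close>, the product rule needs only continuity of the other factor there.  This is
  what gives differentiability of the solution of a linear equation before that solution is known
  to be differentiable.
\<close>

lemma has_derivative_mult_vanishing:
  fixes a :: "'a::real_normed_vector \<Rightarrow> real" and f :: "'a \<Rightarrow> 'b::real_normed_vector"
  assumes "isCont a x" "f x = 0" "(f has_derivative f') (at x)"
  shows "((\<lambda>y. a y *\<^sub>R f y) has_derivative (\<lambda>h. a x *\<^sub>R f' h)) (at x)"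
proof -
  interpret f': bounded_linear f' using assms(3) by (rule has_derivative_bounded_linear)
  obtain C where C: "\<And>h. norm (f' h) \<le> norm h * C" using f'.bounded by blast
  let ?q = "\<lambda>y. norm (f y - f x - f' (y - x)) / norm (y - x)"
  have q: "(?q \<longlongrightarrow> 0) (at x)"
    using assms(3) by (simp add: has_derivative_iff_norm)
  have a: "((\<lambda>y. norm (a y - a x)) \<longlongrightarrow> 0) (at x)"
    by (rule tendsto_norm_zero[OF LIM_zero[OF assms(1)[unfolded isCont_def]]])
  have "((\<lambda>y. (a y - a x) *\<^sub>R f y) has_derivative (\<lambda>h. 0)) (at x)"
  proof (rule has_derivativeI_sandwich[of 1 _ _ _ _ "\<lambda>y. norm (a y - a x) * (C + ?q y)"])
    show "((\<lambda>y. norm (a y - a x) * (C + ?q y)) \<longlongrightarrow> 0) (at x)"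
      using tendsto_mult[OF a tendsto_add[OF tendsto_const[of C] q]] by simp
    show "norm ((a y - a x) *\<^sub>R f y - (a x - a x) *\<^sub>R f x - 0) / norm (y - x)
        \<le> norm (a y - a x) * (C + ?q y)" if "y \<in> UNIV" "y \<noteq> x" "dist y x < 1" for y
    proof -
      have "norm (f y) \<le> norm (f' (y - x)) + norm (f y - f' (y - x))"
        by (metis add.commute diff_add_cancel norm_triangle_ineq)
      also have "\<dots> \<le> norm (y - x) * C + norm (f y - f x - f' (y - x))"
        using C[of "y - x"] assms(2) by simp
      finally have "norm (f y) / norm (y - x) \<le> C + ?q y"
        using that by (simp add: field_simps)
      then have "norm (a y - a x) * (norm (f y) / norm (y - x)) \<le> norm (a y - a x) * (C + ?q y)"
        by (intro mult_left_mono) auto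
      then show ?thesis by simp
    qed
  qed auto
  moreover have "((\<lambda>y. a x *\<^sub>R f y) has_derivative (\<lambda>h. a x *\<^sub>R f' h)) (at x)"
    by (intro has_derivative_scaleR_right assms(3))
  ultimately have "((\<lambda>y. (a y - a x) *\<^sub>R f y + a x *\<^sub>R f y) has_derivative (\<lambda>h. 0 + a x *\<^sub>R f' h)) (at x)"
    by (rule has_derivative_add)
  then show ?thesis by (simp add: algebra_simps)
qed

section \<open>Solving linear equations with parameters\<close>

text \<open>
  Let \<open>A y (g y) = k y\<close> with an injective endomorphism \<open>A y\<close> for each \<open>y\<close>.  Then \<open>g\<close> is as regular as \<open>A\<close>
  and \<open>k\<close>.
\<close>

lemma inj_linear_solve_isCont:
  fixes A :: "'e::euclidean_space \<Rightarrow> 'f::euclidean_space \<Rightarrow> 'f"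
  assumes "open S" "x \<in> S" "\<And>y. y \<in> S \<Longrightarrow> linear (A y)" "inj (A x)"
    and "\<And>u. isCont (\<lambda>y. A y u) x" "isCont k x"
    and "\<And>y. y \<in> S \<Longrightarrow> A y (g y) = k y"
  shows "isCont g x"
proof -
  obtain c where c: "c > 0" "\<And>z. norm (A x z) \<ge> c * norm z"
    using linear_inj_bounded_below_pos[OF assms(3)[OF assms(2)] assms(4)] by metis
  \<comment> \<open>An upper bound for the operator norm of \<open>A y - A x\<close>, which tends to \<open>0\<close> as \<open>y\<close> tends to \<open>x\<close>.\<close>
  define \<epsilon> where "\<epsilon> y = (\<Sum>b\<in>Basis. norm (A y b - A x b))" for y
  have \<epsilon>: "norm (A y z - A x z) \<le> \<epsilon> y * norm z" if "y \<in> S" for y z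
  proof -
    have "A y z - A x z = (\<Sum>b\<in>Basis. (z \<bullet> b) *\<^sub>R (A y b - A x b))"
      using linear_expand[OF assms(3)[OF that], of z] linear_expand[OF assms(3)[OF assms(2)], of z]
      by (simp add: scaleR_diff_right sum_subtractf)
    also have "norm \<dots> \<le> (\<Sum>b\<in>Basis. norm z * norm (A y b - A x b))"
      by (intro sum_norm_le) (auto simp: Basis_le_norm intro!: mult_right_mono)
    finally show ?thesis by (simp add: \<epsilon>_def sum_distrib_left mult.commute)
  qed
  have \<epsilon>0: "(\<epsilon> \<longlongrightarrow> 0) (at x)"
    unfolding \<epsilon>_def using assms(5)
    by (intro tendsto_null_sum tendsto_norm_zero LIM_zero) (auto simp: isCont_def)
  have k0: "((\<lambda>y. norm (k y - k x)) \<longlongrightarrow> 0) (at x)"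
    using assms(6) by (auto simp: isCont_def intro!: tendsto_norm_zero LIM_zero)
  have ev: "\<forall>\<^sub>F y in at x. norm (g y - g x) \<le> (2 / c) * (norm (k y - k x) + \<epsilon> y * norm (g x))"
  proof -
    have "\<forall>\<^sub>F y in at x. \<epsilon> y < c / 2" using order_tendstoD(2)[OF \<epsilon>0, of "c / 2"] c by simp
    moreover have "\<forall>\<^sub>F y in at x. y \<in> S"
      using assms(1,2) by (metis eventually_at_topological)
    ultimately show ?thesis
    proof eventually_elim
      case (elim y)
      have "A x (g y - g x) = (k y - k x) - (A y (g y) - A x (g y))"
        using assms(2,7) elim linear_diff[OF assms(3)[OF assms(2)]] by simp
      then have "c * norm (g y - g x) \<le> norm ((k y - k x) - (A y (g y) - A x (g y)))"
        using c(2) by metis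
      also have "\<dots> \<le> norm (k y - k x) + \<epsilon> y * norm (g y)"
        using \<epsilon>[OF elim(2), of "g y"] norm_triangle_ineq4[of "k y - k x" "A y (g y) - A x (g y)"]
        by linarith
      also have "\<epsilon> y * norm (g y) \<le> \<epsilon> y * (norm (g x) + norm (g y - g x))"
        by (intro mult_left_mono) (auto simp: \<epsilon>_def intro: sum_nonneg norm_triangle_sub)
      also have "\<epsilon> y * (norm (g x) + norm (g y - g x)) \<le> \<epsilon> y * norm (g x) + c / 2 * norm (g y - g x)"
        using elim(1) mult_right_mono[of "\<epsilon> y" "c / 2" "norm (g y - g x)"]
        by (simp add: distrib_left)
      finally have "c * norm (g y - g x) \<le> 2 * (norm (k y - k x) + \<epsilon> y * norm (g x))"
        by (simp add: algebra_simps)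
      then show ?case using c(1) by (simp add: field_simps)
    qed
  qed
  have "((\<lambda>y. (2 / c) * (norm (k y - k x) + \<epsilon> y * norm (g x))) \<longlongrightarrow> 0) (at x)"
    by (intro tendsto_mult_right_zero tendsto_add_zero k0 tendsto_mult_left_zero[OF \<epsilon>0])
  from Lim_null_comparison[OF ev this] show ?thesis
    by (simp add: isCont_def LIM_zero_cancel)
qed

lemma inj_linear_solve_derivative:
  fixes A :: "'e::euclidean_space \<Rightarrow> 'f::euclidean_space \<Rightarrow> 'f"
  assumes "open S" "x \<in> S" "\<And>y. y \<in> S \<Longrightarrow> linear (A y)" "inj (A x)"
    and dA: "\<And>u. (\<lambda>y. A y u) differentiable at x" and dk: "k differentiable at x"
    and sol: "\<And>y. y \<in> S \<Longrightarrow> A y (g y) = k y"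
  shows "g differentiable at x"
    and "A x (fderiv g x v) = fderiv k x v - (\<Sum>b\<in>Basis. (g x \<bullet> b) *\<^sub>R fderiv (\<lambda>y. A y b) x v)"
proof -
  have lx: "linear (A x)" using assms by blast
  have cont: "isCont g x"
    by (rule inj_linear_solve_isCont[where A = A and k = k, OF assms(1-4) _ _ sol])
      (use dA dk in \<open>auto intro: differentiable_imp_continuous_within\<close>)
  obtain L where L: "linear L" "L \<circ> A x = id"
    using linear_injective_left_inverse[OF lx assms(4)] by metis
  have AL: "A x (L z) = z" for z
    using L linear_injective_imp_surjective[OF lx assms(4)] by (metis comp_apply id_apply surjD)
  \<comment> \<open>Near \<open>x\<close>, \<open>A x (g y) = ?r y\<close>, and \<open>A y b - A x b\<close> vanishes at \<open>x\<close>.\<close>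
  let ?r = "\<lambda>y. k y - (\<Sum>b\<in>Basis. (g y \<bullet> b) *\<^sub>R (A y b - A x b))"
  let ?r' = "\<lambda>v. fderiv k x v - (\<Sum>b\<in>Basis. (g x \<bullet> b) *\<^sub>R fderiv (\<lambda>y. A y b) x v)"
  have "((\<lambda>y. A y b - A x b) has_derivative (\<lambda>v. fderiv (\<lambda>y. A y b) x v - 0)) (at x)" for b
    using dA by (intro has_derivative_diff has_derivative_fderiv has_derivative_const) auto
  then have "(?r has_derivative ?r') (at x)"
    using cont by (intro has_derivative_diff has_derivative_sum has_derivative_mult_vanishing
        has_derivative_fderiv[OF dk]) (auto intro: continuous_intros)
  then have "((\<lambda>y. L (?r y)) has_derivative (\<lambda>v. L (?r' v))) (at x)"
    by (rule bounded_linear.has_derivative[OF L(1)[unfolded linear_conv_bounded_linear]])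
  moreover have "L (?r y) = g y" if "y \<in> S" for y
  proof -
    have "(\<Sum>b\<in>Basis. (g y \<bullet> b) *\<^sub>R (A y b - A x b)) = A y (g y) - A x (g y)"
      using linear_expand[OF assms(3)[OF that], of "g y"] linear_expand[OF lx, of "g y"]
      by (simp add: scaleR_diff_right sum_subtractf)
    then have "?r y = A x (g y)" using sol[OF that] by simp
    then show ?thesis using L(2) by (metis comp_apply id_apply)
  qed
  ultimately have dg: "(g has_derivative (\<lambda>v. L (?r' v))) (at x)"
    by (rule has_derivative_transform_within_open[OF _ assms(1,2)])
  then show "g differentiable at x" by (auto simp: differentiable_def)
  show "A x (fderiv g x v) = ?r' v" using fderiv_eq[OF dg] AL by simp
qed

text \<open>
  The directional derivatives of the solution solve an equation of the same kind with another
  right-hand side; so the induction on the order is over all right-hand sides at once.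
\<close>

lemma Ck_on_linear_solve:
  fixes A :: "'e::euclidean_space \<Rightarrow> 'f::euclidean_space \<Rightarrow> 'f"
  assumes "open S" "\<And>y. y \<in> S \<Longrightarrow> linear (A y)" "\<And>y. y \<in> S \<Longrightarrow> inj (A y)"
    and "\<And>u. Ck_on n S (\<lambda>y. A y u)" "Ck_on n S k"
    and "\<And>y. y \<in> S \<Longrightarrow> A y (g y) = k y"
  shows "Ck_on n S g"
  using assms(4-)
proof (induction n arbitrary: k g)
  case 0
  have "isCont g x" if "x \<in> S" for x
  proof (rule inj_linear_solve_isCont[where A = A and k = k, OF assms(1) that assms(2) assms(3)[OF that]])
    show "isCont (\<lambda>y. A y u) x" for u
      using 0(1) that assms(1) by (simp add: continuous_on_eq_continuous_at)
    show "isCont k x"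
      using 0(2) that assms(1) by (simp add: continuous_on_eq_continuous_at)
  qed (simp_all add: 0(3))
  then show ?case by (simp add: continuous_at_imp_continuous_on)
next
  case (Suc n)
  have g: "Ck_on n S g"
    by (rule Suc.IH[OF Ck_on_SucD[OF Suc.prems(1)] Ck_on_SucD[OF Suc.prems(2)] Suc.prems(3)])
  have dA: "(\<lambda>y. A y u) differentiable at x" if "x \<in> S" for x u
    using Suc.prems(1)[of u] that by simp
  have dk: "k differentiable at x" if "x \<in> S" for x
    using Suc.prems(2) that by simp
  have dg: "g differentiable at x" if "x \<in> S" for x
    by (rule inj_linear_solve_derivative(1)[where S = S and A = A and k = k])
      (simp_all add: assms(1-3) that dA dk Suc.prems(3))
  have eq: "A x (fderiv g x v) = fderiv k x v - (\<Sum>b\<in>Basis. (g x \<bullet> b) *\<^sub>R fderiv (\<lambda>y. A y b) x v)"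
    if "x \<in> S" for x v
    by (rule inj_linear_solve_derivative(2)[where S = S and A = A and k = k])
      (simp_all add: assms(1-3) that dA dk Suc.prems(3))
  have "Ck_on n S (\<lambda>x. fderiv g x v)" for v
  proof (rule Suc.IH)
    show "Ck_on n S (\<lambda>y. A y u)" for u using Suc.prems(1) by (rule Ck_on_SucD)
    show "A y (fderiv g y v) = fderiv k y v
        + (\<Sum>b\<in>Basis. (- (g y \<bullet> b)) *\<^sub>R fderiv (\<lambda>y. A y b) y v)" if "y \<in> S" for y
      using eq[OF that] by (simp add: sum_negf)
    have "Ck_on n S (\<lambda>y. fderiv k y v)"
      using Suc.prems(2) by simp
    moreover have "Ck_on n S (\<lambda>y. (- (g y \<bullet> b)) *\<^sub>R fderiv (\<lambda>y. A y b) y v)" for b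
    proof (rule Ck_on_scaleR[OF assms(1)])
      show "Ck_on n S (\<lambda>y. - (g y \<bullet> b))"
        by (rule Ck_on_bounded_linear[OF assms(1) bounded_linear_minus[OF bounded_linear_inner_left] g])
      show "Ck_on n S (\<lambda>y. fderiv (\<lambda>y. A y b) y v)"
        using Suc.prems(1)[of b] by simp
    qed
    ultimately show "Ck_on n S (\<lambda>y. fderiv k y v
        + (\<Sum>b\<in>Basis. (- (g y \<bullet> b)) *\<^sub>R fderiv (\<lambda>y. A y b) y v))"
      by (intro Ck_on_add[OF assms(1)] Ck_on_sum[OF assms(1)])
  qed
  with dg show ?case by simp
qed

section \<open>Symmetry of second derivatives\<close>

text \<open>
  The second difference of \<open>f\<close> over a small parallelogram is a value of the iterated directional
  derivative, by the mean value theorem in each of the two directions.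
\<close>

lemma second_difference_mvt:
  fixes f :: "'a::euclidean_space \<Rightarrow> real"
  assumes h: "h > 0" "h * (norm u + norm v) < r"
    and d: "\<And>y. y \<in> ball x r \<Longrightarrow> f differentiable at y"
    and d2: "\<And>y. y \<in> ball x r \<Longrightarrow> (\<lambda>z. fderiv f z u) differentiable at y"
  shows "\<exists>p\<in>ball x r. f (x + h *\<^sub>R u + h *\<^sub>R v) - f (x + h *\<^sub>R u) - f (x + h *\<^sub>R v) + f x
           = h\<^sup>2 * fderiv (\<lambda>z. fderiv f z u) p v"
proof -
  have inb: "x + s *\<^sub>R u + t *\<^sub>R v \<in> ball x r" if "0 \<le> s" "s \<le> h" "0 \<le> t" "t \<le> h" for s t
  proof -
    have "norm (s *\<^sub>R u + t *\<^sub>R v) \<le> s * norm u + t * norm v"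
      using that norm_triangle_ineq[of "s *\<^sub>R u" "t *\<^sub>R v"] by simp
    also have "\<dots> \<le> h * norm u + h * norm v"
      using that by (intro add_mono mult_right_mono) auto
    finally have "norm (s *\<^sub>R u + t *\<^sub>R v) < r" using h by (simp add: distrib_left)
    moreover have "dist x (x + (s *\<^sub>R u + t *\<^sub>R v)) = norm (s *\<^sub>R u + t *\<^sub>R v)"
      by (metis add_diff_cancel_left' dist_commute dist_norm)
    ultimately show ?thesis by (simp only: mem_ball add.assoc)
  qed
  have line: "((\<lambda>s. q + s *\<^sub>R w) has_derivative (\<lambda>k. k *\<^sub>R w)) (at s)" for q w :: 'a and s
    by (auto intro!: derivative_eq_intros)
  have D: "DERIV (\<lambda>s. F (q + s *\<^sub>R w)) s :> fderiv F (q + s *\<^sub>R w) w"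
    if "F differentiable at (q + s *\<^sub>R w)" for F :: "'a \<Rightarrow> real" and q w s
  proof -
    have "((\<lambda>s. F (q + s *\<^sub>R w)) has_derivative (\<lambda>k. fderiv F (q + s *\<^sub>R w) (k *\<^sub>R w))) (at s)"
      using has_derivative_compose[OF line has_derivative_fderiv[OF that]] .
    then show ?thesis
      by (rule has_derivative_imp_has_field_derivative)
        (simp add: linear_scale[OF linear_frechet_derivative[OF that]])
  qed
  let ?\<phi> = "\<lambda>s. f ((x + h *\<^sub>R v) + s *\<^sub>R u) - f (x + s *\<^sub>R u)"
  have "\<exists>s. 0 < s \<and> s < h \<and> ?\<phi> h - ?\<phi> 0
     = (h - 0) * (fderiv f ((x + h *\<^sub>R v) + s *\<^sub>R u) u - fderiv f (x + s *\<^sub>R u) u)"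
  proof (rule MVT2[OF h(1)])
    fix s assume "0 \<le> s" "s \<le> h"
    then show "DERIV ?\<phi> s :> fderiv f ((x + h *\<^sub>R v) + s *\<^sub>R u) u - fderiv f (x + s *\<^sub>R u) u"
    proof (intro DERIV_diff)
      show "DERIV (\<lambda>s. f ((x + h *\<^sub>R v) + s *\<^sub>R u)) s :> fderiv f ((x + h *\<^sub>R v) + s *\<^sub>R u) u"
        using inb[of s h] h(1) \<open>0 \<le> s\<close> \<open>s \<le> h\<close> by (intro D[of f] d) (simp add: add_ac)
      show "DERIV (\<lambda>s. f (x + s *\<^sub>R u)) s :> fderiv f (x + s *\<^sub>R u) u"
        using inb[of s 0] h(1) \<open>0 \<le> s\<close> \<open>s \<le> h\<close> by (intro D[of f] d) simp
    qed
  qed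
  then obtain s where s: "0 < s" "s < h" and 1: "?\<phi> h - ?\<phi> 0
     = h * (fderiv f ((x + h *\<^sub>R v) + s *\<^sub>R u) u - fderiv f (x + s *\<^sub>R u) u)" by auto
  let ?\<psi> = "\<lambda>t. fderiv f ((x + s *\<^sub>R u) + t *\<^sub>R v) u"
  have "\<exists>t. 0 < t \<and> t < h \<and> ?\<psi> h - ?\<psi> 0
     = (h - 0) * fderiv (\<lambda>z. fderiv f z u) ((x + s *\<^sub>R u) + t *\<^sub>R v) v"
  proof (rule MVT2[OF h(1)])
    fix t assume "0 \<le> t" "t \<le> h"
    then show "DERIV ?\<psi> t :> fderiv (\<lambda>z. fderiv f z u) ((x + s *\<^sub>R u) + t *\<^sub>R v) v"
      using inb[of s t] s by (intro D[of "\<lambda>z. fderiv f z u"] d2) simp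
  qed
  then obtain t where t: "0 < t" "t < h" and 2: "?\<psi> h - ?\<psi> 0
     = h * fderiv (\<lambda>z. fderiv f z u) ((x + s *\<^sub>R u) + t *\<^sub>R v) v" by auto
  show ?thesis
  proof (rule bexI[where x = "x + s *\<^sub>R u + t *\<^sub>R v"])
    show "x + s *\<^sub>R u + t *\<^sub>R v \<in> ball x r" using inb s t by simp
    have "?\<phi> h - ?\<phi> 0 = h * (h * fderiv (\<lambda>z. fderiv f z u) ((x + s *\<^sub>R u) + t *\<^sub>R v) v)"
      unfolding 1 2[symmetric] by (simp add: algebra_simps)
    then show "f (x + h *\<^sub>R u + h *\<^sub>R v) - f (x + h *\<^sub>R u) - f (x + h *\<^sub>R v) + f x
      = h\<^sup>2 * fderiv (\<lambda>z. fderiv f z u) (x + s *\<^sub>R u + t *\<^sub>R v) v"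
      by (simp add: power2_eq_square algebra_simps)
  qed
qed

lemma second_derivative_symmetric_real:
  fixes f :: "'a::euclidean_space \<Rightarrow> real"
  assumes "open S" "x \<in> S" "Ck_on 2 S f"
  shows "fderiv (\<lambda>z. fderiv f z u) x v = fderiv (\<lambda>z. fderiv f z v) x u"
proof (rule ccontr)
  let ?a = "\<lambda>y. fderiv (\<lambda>z. fderiv f z u) y v" and ?b = "\<lambda>y. fderiv (\<lambda>z. fderiv f z v) y u"
  assume ne: "\<not> ?thesis"
  define e where "e = \<bar>?a x - ?b x\<bar> / 2"
  have e: "e > 0" using ne by (simp add: e_def)
  have C: "\<And>y. y \<in> S \<Longrightarrow> f differentiable at y" "\<And>y w. y \<in> S \<Longrightarrow> (\<lambda>z. fderiv f z w) differentiable at y"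
    "continuous_on S ?a" "continuous_on S ?b"
    using assms(3) by (auto simp: numeral_2_eq_2)
  then have "isCont ?a x" "isCont ?b x"
    using assms(1,2) continuous_on_eq_continuous_at by blast+
  then obtain r1 r2 where r1: "r1 > 0" "\<And>y. dist y x < r1 \<Longrightarrow> dist (?a y) (?a x) < e"
    and r2: "r2 > 0" "\<And>y. dist y x < r2 \<Longrightarrow> dist (?b y) (?b x) < e"
    using e unfolding continuous_at_eps_delta by metis
  obtain r3 where r3: "r3 > 0" "ball x r3 \<subseteq> S" using assms(1,2) openE by blast
  define r where "r = min r1 (min r2 r3)"
  have r: "r > 0" using r1 r2 r3 by (simp add: r_def)
  have sub: "ball x r \<subseteq> S" using r3 by (auto simp: r_def)
  \<comment> \<open>The second difference is symmetric in \<open>u\<close> and \<open>v\<close>, so both orders give the same number.\<close>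
  define h where "h = r / (norm u + norm v + 1)"
  have h: "h > 0" "h * (norm u + norm v) < r" "h * (norm v + norm u) < r"
    using r by (auto simp: h_def field_simps add_nonneg_pos add_pos_nonneg intro!: divide_pos_pos)
  obtain p where p: "p \<in> ball x r" "f (x + h *\<^sub>R u + h *\<^sub>R v) - f (x + h *\<^sub>R u) - f (x + h *\<^sub>R v) + f x
           = h\<^sup>2 * ?a p"
    using second_difference_mvt[OF h(1,2), of x f] C sub by blast
  obtain q where q: "q \<in> ball x r" "f (x + h *\<^sub>R v + h *\<^sub>R u) - f (x + h *\<^sub>R v) - f (x + h *\<^sub>R u) + f x
           = h\<^sup>2 * ?b q"
    using second_difference_mvt[OF h(1,3), of x f] C sub by blast
  have "h\<^sup>2 * ?a p = h\<^sup>2 * ?b q"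
    unfolding p(2)[symmetric] q(2)[symmetric] by (simp add: algebra_simps)
  then have "?a p = ?b q" using h by simp
  moreover have "\<bar>?a p - ?a x\<bar> < e" "\<bar>?b q - ?b x\<bar> < e"
    using p(1) q(1) r1(2)[of p] r2(2)[of q] by (auto simp: r_def dist_commute dist_real_def)
  moreover have "\<bar>?a x - ?b x\<bar> = 2 * e" by (simp add: e_def)
  ultimately show False by linarith
qed

lemma second_derivative_symmetric:
  fixes f :: "'a::euclidean_space \<Rightarrow> 'b::euclidean_space"
  assumes "open S" "x \<in> S" "Ck_on 2 S f"
  shows "fderiv (\<lambda>z. fderiv f z u) x v = fderiv (\<lambda>z. fderiv f z v) x u"
proof (rule euclidean_eqI)
  fix b :: 'b
  have C: "f differentiable at y" "(\<lambda>z. fderiv f z w) differentiable at y" if "y \<in> S" for y w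
    using assms(3) that by (auto simp: numeral_2_eq_2)
  have i: "fderiv (\<lambda>z. g z \<bullet> b) y w = fderiv g y w \<bullet> b" "(\<lambda>z. g z \<bullet> b) differentiable at y"
    if "g differentiable at y" for g :: "'a \<Rightarrow> 'b" and y w
    using has_derivative_inner_left[OF has_derivative_fderiv[OF that], of b]
    by (auto simp: fderiv_eq differentiable_def)
  have *: "fderiv (\<lambda>z. fderiv (\<lambda>z. f z \<bullet> b) z u) x v = fderiv (\<lambda>z. fderiv f z u) x v \<bullet> b" for u v
  proof -
    have "fderiv (\<lambda>z. fderiv (\<lambda>z. f z \<bullet> b) z u) x = fderiv (\<lambda>z. fderiv f z u \<bullet> b) x"
      by (rule fderiv_cong_open[OF assms(1,2)]) (use i C assms(2) in auto)
    then show ?thesis using i C assms(2) by simp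
  qed
  have "Ck_on 2 S (\<lambda>z. f z \<bullet> b)"
    by (rule Ck_on_bounded_linear[OF assms(1) bounded_linear_inner_left assms(3)])
  from second_derivative_symmetric_real[OF assms(1,2) this, of u v]
  show "fderiv (\<lambda>z. fderiv f z u) x v \<bullet> b = fderiv (\<lambda>z. fderiv f z v) x u \<bullet> b"
    by (simp add: *)
qed

section \<open>Leibniz rules for forms with parameters\<close>

lemma has_derivative_linear_apply:
  fixes L :: "'a::real_normed_vector \<Rightarrow> 'b::euclidean_space \<Rightarrow> 'c::real_normed_vector"
  assumes "open S" "x \<in> S" and lin: "\<And>y. y \<in> S \<Longrightarrow> linear (L y)"
    and dL: "\<And>u. (\<lambda>y. L y u) differentiable at x" and dU: "U differentiable at x"
  shows "((\<lambda>y. L y (U y)) has_derivative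
           (\<lambda>h. fderiv (\<lambda>y. L y (U x)) x h + L x (fderiv U x h))) (at x)"
proof -
  have D: "((\<lambda>y. L y (V y)) has_derivative
      (\<lambda>h. (\<Sum>b\<in>Basis. (V x \<bullet> b) *\<^sub>R fderiv (\<lambda>y. L y b) x h) + L x (fderiv V x h))) (at x)"
    if V: "V differentiable at x" for V
  proof -
    have "((\<lambda>y. \<Sum>b\<in>Basis. (V y \<bullet> b) *\<^sub>R L y b) has_derivative (\<lambda>h. \<Sum>b\<in>Basis.
        (V x \<bullet> b) *\<^sub>R fderiv (\<lambda>y. L y b) x h + (fderiv V x h \<bullet> b) *\<^sub>R L x b)) (at x)"
    proof (intro has_derivative_sum has_derivative_scaleR)
      show "((\<lambda>y. V y \<bullet> b) has_derivative (\<lambda>h. fderiv V x h \<bullet> b)) (at x)" for b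
        by (rule has_derivative_inner_left[OF has_derivative_fderiv[OF V]])
    qed (rule has_derivative_fderiv[OF dL])
    then have "((\<lambda>y. L y (V y)) has_derivative (\<lambda>h. \<Sum>b\<in>Basis.
        (V x \<bullet> b) *\<^sub>R fderiv (\<lambda>y. L y b) x h + (fderiv V x h \<bullet> b) *\<^sub>R L x b)) (at x)"
      by (rule has_derivative_transform_within_open[OF _ assms(1,2)])
        (simp add: linear_expand[OF lin, symmetric])
    then show ?thesis
      by (simp add: sum.distrib linear_expand[OF lin[OF assms(2)], symmetric])
  qed
  have "fderiv (\<lambda>y. L y (U x)) x h = (\<Sum>b\<in>Basis. (U x \<bullet> b) *\<^sub>R fderiv (\<lambda>y. L y b) x h)" for h
    using fderiv_eq[OF D[OF differentiable_const], of "U x" h] linear_0[OF lin[OF assms(2)]] by simp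
  then show ?thesis using D[OF dU] by simp
qed

lemma fderiv_linear_param:
  fixes L :: "'a::real_normed_vector \<Rightarrow> 'b::real_vector \<Rightarrow> 'c::real_normed_vector"
  assumes "open S" "x \<in> S" and lin: "\<And>y. y \<in> S \<Longrightarrow> linear (L y)"
    and dL: "\<And>u. (\<lambda>y. L y u) differentiable at x"
  shows "linear (\<lambda>u. fderiv (\<lambda>y. L y u) x h)"
proof (rule linearI)
  fix u v :: 'b and c :: real
  have "((\<lambda>y. L y u + L y v) has_derivative
      (\<lambda>h. fderiv (\<lambda>y. L y u) x h + fderiv (\<lambda>y. L y v) x h)) (at x)"
    by (intro has_derivative_add has_derivative_fderiv[OF dL])
  then have "((\<lambda>y. L y (u + v)) has_derivative
      (\<lambda>h. fderiv (\<lambda>y. L y u) x h + fderiv (\<lambda>y. L y v) x h)) (at x)"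
    by (rule has_derivative_transform_within_open[OF _ assms(1,2)]) (simp add: linear_add[OF lin])
  then show "fderiv (\<lambda>y. L y (u + v)) x h = fderiv (\<lambda>y. L y u) x h + fderiv (\<lambda>y. L y v) x h"
    by (rule fderiv_eq)
  have "((\<lambda>y. c *\<^sub>R L y u) has_derivative (\<lambda>h. c *\<^sub>R fderiv (\<lambda>y. L y u) x h)) (at x)"
    by (intro has_derivative_scaleR_right has_derivative_fderiv[OF dL])
  then have "((\<lambda>y. L y (c *\<^sub>R u)) has_derivative (\<lambda>h. c *\<^sub>R fderiv (\<lambda>y. L y u) x h)) (at x)"
    by (rule has_derivative_transform_within_open[OF _ assms(1,2)]) (simp add: linear_scale[OF lin])
  then show "fderiv (\<lambda>y. L y (c *\<^sub>R u)) x h = c *\<^sub>R fderiv (\<lambda>y. L y u) x h"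
    by (rule fderiv_eq)
qed

lemma has_derivative_bilinear_apply:
  fixes B :: "'a::real_normed_vector \<Rightarrow> 'b::euclidean_space \<Rightarrow> 'c::euclidean_space \<Rightarrow> 'd::real_normed_vector"
  assumes "open S" "x \<in> S" and bil: "\<And>y. y \<in> S \<Longrightarrow> bilinear (B y)"
    and dB: "\<And>u v. (\<lambda>y. B y u v) differentiable at x"
    and dU: "U differentiable at x" and dV: "V differentiable at x"
  shows "((\<lambda>y. B y (U y) (V y)) has_derivative
           (\<lambda>h. fderiv (\<lambda>y. B y (U x) (V x)) x h + B x (fderiv U x h) (V x)
              + B x (U x) (fderiv V x h))) (at x)"
proof -
  have D: "((\<lambda>y. B y (U y) v) has_derivative
      (\<lambda>h. fderiv (\<lambda>y. B y (U x) v) x h + B x (fderiv U x h) v)) (at x)" for v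
    by (rule has_derivative_linear_apply[where L = "\<lambda>y u. B y u v", OF assms(1,2) _ dB dU])
      (use bil in \<open>simp add: bilinear_def\<close>)
  have "((\<lambda>y. B y (U y) (V y)) has_derivative
      (\<lambda>h. fderiv (\<lambda>y. B y (U y) (V x)) x h + B x (U x) (fderiv V x h))) (at x)"
  proof (rule has_derivative_linear_apply[where L = "\<lambda>y. B y (U y)", OF assms(1,2) _ _ dV])
    show "(\<lambda>y. B y (U y) v) differentiable at x" for v
      using D by (auto simp: differentiable_def)
  qed (use bil in \<open>simp add: bilinear_def\<close>)
  then show ?thesis by (simp add: fderiv_eq[OF D])
qed

section \<open>The Levi-Civita connection of a local metric\<close>

text \<open>The algebra behind the uniqueness of the Levi-Civita connection.\<close>

lemma sym_skew_imp_zero: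
  fixes T :: "'a \<Rightarrow> 'a \<Rightarrow> 'a \<Rightarrow> real"
  assumes "\<And>u v w. T u v w = T v u w" "\<And>u v w. T u v w = - T u w v"
  shows "T u v w = 0"
proof -
  have "T u v w = - T u w v" by (rule assms)
  also have "T u w v = T w u v" by (rule assms)
  also have "T w u v = - T w v u" by (rule assms)
  also have "T w v u = T v w u" by (rule assms)
  also have "T v w u = - T v u w" by (rule assms)
  also have "T v u w = T u v w" by (rule assms)
  finally show ?thesis by simp
qed

lemma sum_Basis_inner:
  fixes l :: "'a::euclidean_space \<Rightarrow> real"
  assumes "linear l"
  shows "(\<Sum>b\<in>Basis. l b *\<^sub>R b) \<bullet> w = l w"
  using linear_expand[OF assms, of w]
  by (simp add: inner_sum_left mult.commute inner_commute[of w])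

text \<open>
  A Riemannian metric on an open set \<open>S\<close> of the model space, such as the coordinate image of a chart.
\<close>

locale chart_metric =
  fixes S :: "'e::euclidean_space set" and G :: "'e \<Rightarrow> 'e \<Rightarrow> 'e \<Rightarrow> real"
  assumes open_S: "open S" and local_metric: "local_metric S G"
begin

lemma Ck_metric: "Ck_on k S (\<lambda>y. G y u v)"
  using local_metric by (simp add: local_metric_def smooth_on_def)

lemma metric_bilinear: "y \<in> S \<Longrightarrow> bilinear (G y)"
  and metric_sym: "y \<in> S \<Longrightarrow> G y u v = G y v u"
  and metric_pos: "y \<in> S \<Longrightarrow> u \<noteq> 0 \<Longrightarrow> G y u u > 0"
  using local_metric by (auto simp: local_metric_def)

lemma metric_linear: "y \<in> S \<Longrightarrow> linear (G y u)" "y \<in> S \<Longrightarrow> linear (\<lambda>u. G y u v)"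
  using metric_bilinear by (auto simp: bilinear_def)

lemmas metric_simps =
  linear_add[OF metric_linear(1)] linear_add[OF metric_linear(2)]
  linear_diff[OF metric_linear(1)] linear_diff[OF metric_linear(2)]
  linear_neg[OF metric_linear(1)] linear_neg[OF metric_linear(2)]
  linear_0[OF metric_linear(1)] linear_0[OF metric_linear(2)]
  linear_scale[OF metric_linear(1)] linear_scale[OF metric_linear(2)]

lemma metric_nondegenerate:
  assumes "y \<in> S" "\<And>w. G y u w = G y v w"
  shows "u = v"
proof (rule ccontr)
  assume "u \<noteq> v"
  then have "G y (u - v) (u - v) > 0" using assms(1) by (intro metric_pos) auto
  then show False using assms by (simp add: metric_simps)
qed

lemma metric_differentiable: "y \<in> S \<Longrightarrow> (\<lambda>y. G y u v) differentiable at y"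
  using Ck_metric[of "Suc 0" u v] by simp

text \<open>\<open>dG x u v w\<close> is the derivative of \<open>\<langle>v, w\<rangle>\<close> at \<open>x\<close> in the direction \<open>u\<close>, for constant \<open>v\<close>, \<open>w\<close>.\<close>

abbreviation dG :: "'e \<Rightarrow> 'e \<Rightarrow> 'e \<Rightarrow> 'e \<Rightarrow> real" where
  "dG x u v w \<equiv> fderiv (\<lambda>y. G y v w) x u"

lemma dG_sym: "x \<in> S \<Longrightarrow> dG x u v w = dG x u w v"
  by (subst fderiv_cong_open[OF open_S, of x "\<lambda>y. G y w v"])
    (auto intro: metric_sym metric_differentiable)

lemma dG_linear:
  assumes "x \<in> S"
  shows "linear (\<lambda>u. dG x u v w)" "linear (\<lambda>v. dG x u v w)" "linear (dG x u v)"
proof -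
  show "linear (\<lambda>u. dG x u v w)"
    by (rule linear_frechet_derivative[OF metric_differentiable[OF assms]])
  show "linear (\<lambda>v. dG x u v w)"
    by (rule fderiv_linear_param[where L = "\<lambda>y v. G y v w", OF open_S assms metric_linear(2)
          metric_differentiable[OF assms]])
  show "linear (dG x u v)"
    by (rule fderiv_linear_param[where L = "\<lambda>y. G y v", OF open_S assms metric_linear(1)
          metric_differentiable[OF assms]])
qed

text \<open>
  \<open>flat y\<close> is the metric at \<open>y\<close> as an endomorphism of the model space, and \<open>koszul y u v\<close> represents
  the right-hand side of the Koszul formula by the Euclidean inner product, so that the Christoffel
  form solves the linear equation \<open>flat y (christoffel G y u v) = koszul y u v\<close>.
\<close>

definition flat :: "'e \<Rightarrow> 'e \<Rightarrow> 'e" where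
  "flat y z = (\<Sum>b\<in>Basis. G y z b *\<^sub>R b)"

definition koszul_form :: "'e \<Rightarrow> 'e \<Rightarrow> 'e \<Rightarrow> 'e \<Rightarrow> real" where
  "koszul_form y u v w = (dG y u v w + dG y v u w - dG y w u v) / 2"

definition koszul :: "'e \<Rightarrow> 'e \<Rightarrow> 'e \<Rightarrow> 'e" where
  "koszul y u v = (\<Sum>b\<in>Basis. koszul_form y u v b *\<^sub>R b)"

lemma flat_inner: "y \<in> S \<Longrightarrow> flat y z \<bullet> w = G y z w"
  unfolding flat_def by (rule sum_Basis_inner[OF metric_linear(1)])

lemma flat_linear: "y \<in> S \<Longrightarrow> linear (flat y)"
  by (rule linearI)
    (simp_all add: flat_def metric_simps sum.distrib scaleR_add_left scaleR_sum_right)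

lemma flat_inj: "y \<in> S \<Longrightarrow> inj (flat y)"
  by (rule injI) (metis flat_inner metric_nondegenerate)

lemma flat_surj: "y \<in> S \<Longrightarrow> surj (flat y)"
  by (simp add: linear_injective_imp_surjective flat_linear flat_inj)

lemma koszul_form_linear: "y \<in> S \<Longrightarrow> linear (koszul_form y u v)"
  by (rule linearI)
    (simp_all add: koszul_form_def linear_add[OF dG_linear(3)] linear_add[OF dG_linear(1)]
      linear_scale[OF dG_linear(3)] linear_scale[OF dG_linear(1)] field_simps)

lemma koszul_inner: "y \<in> S \<Longrightarrow> koszul y u v \<bullet> w = koszul_form y u v w"
  unfolding koszul_def by (rule sum_Basis_inner[OF koszul_form_linear])

lemma koszul_bilinear: "y \<in> S \<Longrightarrow> bilinear (koszul y)"
  unfolding bilinear_def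
  by (intro conjI allI linearI; rule vector_eq_rdot[THEN iffD1])
    (simp_all add: inner_add_left koszul_inner koszul_form_def
      linear_add[OF dG_linear(1)] linear_add[OF dG_linear(2)] linear_add[OF dG_linear(3)]
      linear_scale[OF dG_linear(1)] linear_scale[OF dG_linear(2)] linear_scale[OF dG_linear(3)]
      field_simps)

text \<open>
  The characterization of the Levi-Civita connection form at \<open>x\<close>: bilinear, torsion-free and metric.
\<close>

definition is_levi_civita :: "'e \<Rightarrow> ('e \<Rightarrow> 'e \<Rightarrow> 'e) \<Rightarrow> bool" where
  "is_levi_civita x \<Gamma> \<longleftrightarrow> bilinear \<Gamma> \<and> (\<forall>u v. \<Gamma> u v = \<Gamma> v u) \<and>
     (\<forall>u v w. dG x u v w = G x (\<Gamma> u v) w + G x v (\<Gamma> u w))"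

lemma levi_civita_exists:
  assumes "x \<in> S"
  shows "is_levi_civita x (\<lambda>u v. inv (flat x) (koszul x u v))" (is "is_levi_civita x ?\<Gamma>")
proof -
  note surj = flat_surj[OF assms]
  have \<Gamma>: "G x (?\<Gamma> u v) w = koszul_form x u v w" for u v w
    using flat_inner[OF assms] surj_f_inv_f[OF surj] koszul_inner[OF assms] by metis
  have inv: "linear (inv (flat x))"
    using flat_inj[OF assms] flat_linear[OF assms] surj by (metis inj_linear_imp_inv_linear)
  have "bilinear ?\<Gamma>"
    unfolding bilinear_def
  proof (intro conjI allI)
    show "linear (?\<Gamma> u)" for u
      using linear_compose[OF _ inv, of "koszul x u"] koszul_bilinear[OF assms]
      by (simp add: bilinear_def o_def)
    show "linear (\<lambda>u. ?\<Gamma> u v)" for v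
      using linear_compose[OF _ inv, of "\<lambda>u. koszul x u v"] koszul_bilinear[OF assms]
      by (simp add: bilinear_def o_def)
  qed
  moreover have "?\<Gamma> u v = ?\<Gamma> v u" for u v
  proof (rule metric_nondegenerate[OF assms])
    show "G x (?\<Gamma> u v) w = G x (?\<Gamma> v u) w" for w
      using dG_sym[OF assms, where u = w and v = u and w = v] by (simp add: \<Gamma> koszul_form_def)
  qed
  moreover have "dG x u v w = G x (?\<Gamma> u v) w + G x v (?\<Gamma> u w)" for u v w
    using dG_sym[OF assms, where u = u and v = v and w = w]
      dG_sym[OF assms, where u = v and v = u and w = w] dG_sym[OF assms, where u = w and v = u and w = v]
    by (simp add: metric_sym[OF assms, of v] \<Gamma> koszul_form_def field_simps)
  ultimately show ?thesis by (simp add: is_levi_civita_def)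
qed

lemma levi_civita_unique:
  assumes "x \<in> S" "is_levi_civita x \<Gamma>" "is_levi_civita x \<Gamma>'"
  shows "\<Gamma> = \<Gamma>'"
proof (intro ext, rule metric_nondegenerate[OF assms(1)])
  fix u v w
  have "G x (\<Gamma> u v - \<Gamma>' u v) w = 0"
  proof (rule sym_skew_imp_zero[of "\<lambda>u v w. G x (\<Gamma> u v - \<Gamma>' u v) w"])
    fix u v w
    show "G x (\<Gamma> u v - \<Gamma>' u v) w = G x (\<Gamma> v u - \<Gamma>' v u) w"
      using assms(2,3) unfolding is_levi_civita_def by metis
    have "dG x u v w = G x (\<Gamma> u v) w + G x v (\<Gamma> u w)" "dG x u v w = G x (\<Gamma>' u v) w + G x v (\<Gamma>' u w)"
      using assms(2,3) unfolding is_levi_civita_def by blast+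
    then show "G x (\<Gamma> u v - \<Gamma>' u v) w = - G x (\<Gamma> u w - \<Gamma>' u w) v"
      by (simp add: metric_simps[OF assms(1)] metric_sym[OF assms(1), of v])
  qed
  then show "G x (\<Gamma> u v) w = G x (\<Gamma>' u v) w" by (simp add: metric_simps[OF assms(1)])
qed

abbreviation \<Gamma> :: "'e \<Rightarrow> 'e \<Rightarrow> 'e \<Rightarrow> 'e" where "\<Gamma> \<equiv> christoffel G"

lemma christoffel_levi_civita: "x \<in> S \<Longrightarrow> is_levi_civita x (\<Gamma> x)"
  unfolding christoffel_def is_levi_civita_def[symmetric]
  by (rule theI[where P = "is_levi_civita x", OF levi_civita_exists levi_civita_unique])
    (assumption | rule levi_civita_exists)+

lemma christoffel_bilinear: "x \<in> S \<Longrightarrow> bilinear (\<Gamma> x)"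
  and christoffel_sym: "x \<in> S \<Longrightarrow> \<Gamma> x u v = \<Gamma> x v u"
  and christoffel_compatible: "x \<in> S \<Longrightarrow> dG x u v w = G x (\<Gamma> x u v) w + G x v (\<Gamma> x u w)"
  using christoffel_levi_civita[of x] unfolding is_levi_civita_def by blast+

lemma flat_christoffel:
  assumes "x \<in> S"
  shows "flat x (\<Gamma> x u v) = koszul x u v"
proof -
  have "\<Gamma> x = (\<lambda>u v. inv (flat x) (koszul x u v))"
    by (rule levi_civita_unique[OF assms christoffel_levi_civita[OF assms] levi_civita_exists[OF assms]])
  then show ?thesis by (simp only: surj_f_inv_f[OF flat_surj[OF assms]])
qed

lemma Ck_christoffel: "Ck_on k S (\<lambda>x. \<Gamma> x u v)"
proof (rule Ck_on_linear_solve[where A = flat, OF open_S flat_linear flat_inj _ _ flat_christoffel])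
  show "Ck_on k S (\<lambda>y. flat y z)" for z
    unfolding flat_def
    by (rule Ck_on_sum[OF open_S Ck_on_scaleR[OF open_S Ck_metric Ck_on_const]])
  have d: "Ck_on k S (\<lambda>x. dG x u v w)" for u v w
    using Ck_metric[of "Suc k" v w] by simp
  have "Ck_on k S (\<lambda>x. koszul_form x u v b)" for b
  proof -
    have "koszul_form x u v b = (1 / 2) *\<^sub>R ((dG x u v b + dG x v u b) + (- 1) *\<^sub>R dG x b u v)" for x
      by (simp add: koszul_form_def)
    moreover have "Ck_on k S (\<lambda>x. (1 / 2) *\<^sub>R ((dG x u v b + dG x v u b) + (- 1) *\<^sub>R dG x b u v))"
      by (rule Ck_on_scaleR[OF open_S Ck_on_const Ck_on_add[OF open_S Ck_on_add[OF open_S d d]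
              Ck_on_scaleR[OF open_S Ck_on_const d]]])
    ultimately show ?thesis by (simp only:)
  qed
  then show "Ck_on k S (\<lambda>x. koszul x u v)"
    unfolding koszul_def by (rule Ck_on_sum[OF open_S Ck_on_scaleR[OF open_S _ Ck_on_const]])
qed

lemma christoffel_differentiable: "x \<in> S \<Longrightarrow> (\<lambda>x. \<Gamma> x u v) differentiable at x"
  using Ck_christoffel[of "Suc 0" u v] by simp

text \<open>Metric compatibility of the connection induced on the pull-back bundle.\<close>

lemma nabla_pull_metric:
  fixes F :: "'a::euclidean_space \<Rightarrow> 'e"
  assumes "open W" "x \<in> W" "F ` W \<subseteq> S" and dF: "F differentiable at x"
    and dU: "U differentiable at x" and dV: "V differentiable at x"
  shows "fderiv (\<lambda>z. G (F z) (U z) (V z)) x (X x) =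
    G (F x) (nabla_pull G F X U x) (V x) + G (F x) (U x) (nabla_pull G F X V x)"
proof -
  have Fx: "F z \<in> S" if "z \<in> W" for z using assms(3) that by auto
  note S = Fx[OF assms(2)]
  have D: "((\<lambda>z. G (F z) u v) has_derivative (\<lambda>h. dG (F x) (fderiv F x h) u v)) (at x)" for u v
    by (rule has_derivative_compose[where g = "\<lambda>y. G y u v", OF has_derivative_fderiv[OF dF]
          has_derivative_fderiv[OF metric_differentiable[OF S]]])
  have "((\<lambda>z. G (F z) (U z) (V z)) has_derivative
     (\<lambda>h. fderiv (\<lambda>z. G (F z) (U x) (V x)) x h + G (F x) (fderiv U x h) (V x)
              + G (F x) (U x) (fderiv V x h))) (at x)"
    by (rule has_derivative_bilinear_apply[where B = "\<lambda>z. G (F z)", OF assms(1,2) metric_bilinear[OF Fx] _ dU dV])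
      (use D in \<open>auto simp: differentiable_def\<close>)
  from fderiv_eq[OF this, of "X x"] show ?thesis
    by (simp add: fderiv_eq[OF D] christoffel_compatible[OF S] nabla_pull_def push_def metric_simps[OF S])
qed

end

section \<open>Curvature\<close>

text \<open>
  A tensor with the symmetries of a curvature tensor vanishes if all its sectional curvatures do.
  Polarization of \<open>T u v v u = 0\<close> makes \<open>T\<close> skew in the first and last argument, hence totally skew,
  and then the Bianchi identity reads \<open>3 T = 0\<close>.
\<close>

lemma curvature_like_eq_zero:
  fixes T :: "'a::ab_group_add \<Rightarrow> 'a \<Rightarrow> 'a \<Rightarrow> 'a \<Rightarrow> real"
  assumes add1: "\<And>a b v w z. T (a + b) v w z = T a v w z + T b v w z"
    and add2: "\<And>u a b w z. T u (a + b) w z = T u a w z + T u b w z"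
    and add3: "\<And>u v a b z. T u v (a + b) z = T u v a z + T u v b z"
    and add4: "\<And>u v w a b. T u v w (a + b) = T u v w a + T u v w b"
    and skew12: "\<And>u v w z. T u v w z = - T v u w z"
    and skew34: "\<And>u v w z. T u v w z = - T u v z w"
    and bianchi: "\<And>u v w z. T u v w z + T v w u z + T w u v z = 0"
    and sec: "\<And>u v. T u v v u = 0"
  shows "T u v w z = 0"
proof -
  have pair: "T w u v z = T v z w u" for u v w z
    using bianchi[of u v w z] bianchi[of v w z u] bianchi[of w z u v] bianchi[of z u v w]
      skew34[of u v w z] skew34[of v w u z] skew34[of w z v u] skew34[of z u w v]
      skew12[of u w z v] skew34[of w u z v] skew12[of v z u w] skew34[of z v u w]
      skew34[of v z u w]
    by linarith
  have polar: "T u v w u = 0" for u v w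
    using sec[of u "v + w"] sec[of u v] sec[of u w] pair[where w = u and u = w and v = v and z = u] skew12[of v u u w] skew34[of u v u w]
    by (simp add: add2 add3)
  have skew14: "T u v w z = - T z v w u" for u v w z
    using polar[of "u + z" v w] polar[of u v w] polar[of z v w] by (simp add: add1 add4)
  have skew13: "T a b c d = - T c b a d" for a b c d
    using skew34[of a b c d] skew14[of a b d c] skew34[of c b d a] by linarith
  have "T v w u z = T u v w z" for u v w
    using skew12[of v w u z] skew13[of w v u z] by linarith
  from this[of u v w] this[of v w u] show ?thesis
    using bianchi[of u v w z] by linarith
qed

context chart_metric
begin

text \<open>The derivative of \<open>\<Gamma> v w\<close> at \<open>x\<close> in the direction \<open>u\<close>, for constant \<open>v\<close>, \<open>w\<close>.\<close>

abbreviation d\<Gamma> :: "'e \<Rightarrow> 'e \<Rightarrow> 'e \<Rightarrow> 'e \<Rightarrow> 'e" where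
  "d\<Gamma> x u v w \<equiv> fderiv (\<lambda>y. \<Gamma> y v w) x u"

lemma christoffel_linear: "x \<in> S \<Longrightarrow> linear (\<Gamma> x u)" "x \<in> S \<Longrightarrow> linear (\<lambda>u. \<Gamma> x u v)"
  using christoffel_bilinear by (auto simp: bilinear_def)

lemma dchristoffel_linear:
  assumes "x \<in> S"
  shows "linear (\<lambda>u. d\<Gamma> x u v w)" "linear (\<lambda>v. d\<Gamma> x u v w)" "linear (d\<Gamma> x u v)"
proof -
  show "linear (\<lambda>u. d\<Gamma> x u v w)"
    by (rule linear_frechet_derivative[OF christoffel_differentiable[OF assms]])
  show "linear (\<lambda>v. d\<Gamma> x u v w)"
    by (rule fderiv_linear_param[where L = "\<lambda>y v. \<Gamma> y v w", OF open_S assms christoffel_linear(2)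
          christoffel_differentiable[OF assms]])
  show "linear (d\<Gamma> x u v)"
    by (rule fderiv_linear_param[where L = "\<lambda>y. \<Gamma> y v", OF open_S assms christoffel_linear(1)
          christoffel_differentiable[OF assms]])
qed

lemma dchristoffel_sym: "x \<in> S \<Longrightarrow> d\<Gamma> x u v w = d\<Gamma> x u w v"
  by (subst fderiv_cong_open[OF open_S, of x "\<lambda>y. \<Gamma> y w v"])
    (auto intro: christoffel_sym christoffel_differentiable)

lemmas christoffel_simps =
  linear_add[OF christoffel_linear(1)] linear_add[OF christoffel_linear(2)]
  linear_scale[OF christoffel_linear(1)] linear_scale[OF christoffel_linear(2)]
  linear_add[OF dchristoffel_linear(1)] linear_add[OF dchristoffel_linear(2)]
  linear_add[OF dchristoffel_linear(3)]
  linear_scale[OF dchristoffel_linear(1)] linear_scale[OF dchristoffel_linear(2)]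
  linear_scale[OF dchristoffel_linear(3)]

lemma curvature_eq:
  assumes "x \<in> S"
  shows "curvature G x u v w =
    d\<Gamma> x u v w + \<Gamma> x u (\<Gamma> x v w) - (d\<Gamma> x v u w + \<Gamma> x v (\<Gamma> x u w))"
proof -
  have "nabla G (\<lambda>_. a) (\<lambda>_. w) = (\<lambda>y. \<Gamma> y a w)" for a
    by (rule ext) (simp add: nabla_def)
  moreover have "lie_bracket (\<lambda>_. u) (\<lambda>_. v) = (\<lambda>_. 0)"
    by (rule ext) (simp add: lie_bracket_def)
  ultimately show ?thesis
    using linear_0[OF christoffel_linear(2)[OF assms]]
    by (simp add: curvature_def curvature_op_def nabla_def)
qed

lemma curvature_linear:
  assumes "x \<in> S"
  shows "linear (\<lambda>u. curvature G x u v w)" "linear (\<lambda>v. curvature G x u v w)"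
    "linear (curvature G x u v)"
  by (rule linearI; simp add: curvature_eq[OF assms] christoffel_simps[OF assms]
      scaleR_diff_right scaleR_add_right)+

lemma curvature_skew: "x \<in> S \<Longrightarrow> curvature G x u v w = - curvature G x v u w"
  by (simp add: curvature_eq)

lemma curvature_bianchi:
  assumes "x \<in> S"
  shows "curvature G x u v w + curvature G x v w u + curvature G x w u v = 0"
  using dchristoffel_sym[OF assms, where u = u and v = v and w = w]
    dchristoffel_sym[OF assms, where u = v and v = u and w = w]
    dchristoffel_sym[OF assms, where u = w and v = u and w = v]
    christoffel_sym[OF assms, of v w] christoffel_sym[OF assms, of u w] christoffel_sym[OF assms, of u v]
  by (simp add: curvature_eq[OF assms])

text \<open>
  Skewness in the last two arguments expresses that the second derivatives of \<open>y \<mapsto> G y w w\<close>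
  commute.
\<close>

lemma curvature_metric_skew:
  assumes "x \<in> S"
  shows "G x (curvature G x u v w) w = 0"
proof -
  have D: "fderiv (\<lambda>y. dG y v w w) x u
    = 2 * (G x (d\<Gamma> x u v w) w + G x (\<Gamma> x u (\<Gamma> x v w)) w + G x (\<Gamma> x v w) (\<Gamma> x u w))" for u v
  proof -
    have "((\<lambda>y. G y (\<Gamma> y v w) w) has_derivative
        (\<lambda>h. dG x h (\<Gamma> x v w) w + G x (d\<Gamma> x h v w) w + G x (\<Gamma> x v w) (fderiv (\<lambda>_. w) x h))) (at x)"
      by (rule has_derivative_bilinear_apply[where B = G, OF open_S assms metric_bilinear
            metric_differentiable[OF assms] christoffel_differentiable[OF assms] differentiable_const])
    then have "((\<lambda>y. 2 * G y (\<Gamma> y v w) w) has_derivative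
        (\<lambda>h. 2 * (dG x h (\<Gamma> x v w) w + G x (d\<Gamma> x h v w) w + G x (\<Gamma> x v w) (fderiv (\<lambda>_. w) x h)))) (at x)"
      by (rule has_derivative_mult_right)
    then have "((\<lambda>y. dG y v w w) has_derivative
        (\<lambda>h. 2 * (dG x h (\<Gamma> x v w) w + G x (d\<Gamma> x h v w) w + G x (\<Gamma> x v w) (fderiv (\<lambda>_. w) x h)))) (at x)"
      by (rule has_derivative_transform_within_open[OF _ open_S assms])
        (simp add: christoffel_compatible metric_sym[of _ w])
    from fderiv_eq[OF this, of u] show ?thesis
      by (simp add: metric_simps(7)[OF assms] christoffel_compatible[OF assms])
  qed
  have "fderiv (\<lambda>y. dG y v w w) x u = fderiv (\<lambda>y. dG y u w w) x v"
    by (rule second_derivative_symmetric_real[OF open_S assms Ck_metric])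
  then have "G x (d\<Gamma> x u v w) w + G x (\<Gamma> x u (\<Gamma> x v w)) w
      = G x (d\<Gamma> x v u w) w + G x (\<Gamma> x v (\<Gamma> x u w)) w"
    unfolding D using metric_sym[OF assms, of "\<Gamma> x u w" "\<Gamma> x v w"] by simp
  then show ?thesis
    by (simp add: curvature_eq[OF assms] metric_simps[OF assms])
qed

lemma constant_curvature_eq:
  assumes "x \<in> S"
    and K: "\<And>u v. u \<noteq> v \<Longrightarrow> independent {u, v} \<Longrightarrow> sectional_curvature G x u v = K"
  shows "curvature G x u v w = K *\<^sub>R (G x v w *\<^sub>R u - G x u w *\<^sub>R v)"
proof -
  note ms = metric_simps[OF assms(1)]
  define T where "T u v w z = G x (curvature G x u v w) z - K * (G x v w * G x u z - G x u w * G x v z)"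
    for u v w z
  have sec: "T u v v u = 0" for u v
  proof (cases "v = 0 \<or> (\<exists>c. u = c *\<^sub>R v)")
    case True
    then show ?thesis
    proof (elim disjE exE)
      assume "v = 0"
      then show ?thesis
        by (simp add: T_def linear_0[OF curvature_linear(3)[OF assms(1)]] ms)
    next
      fix c assume c: "u = c *\<^sub>R v"
      have "curvature G x v v v = 0"
        by (simp add: curvature_eq[OF assms(1)])
      then show ?thesis
        by (simp add: T_def c linear_scale[OF curvature_linear(1)[OF assms(1)]] ms)
    qed
  next
    case False
    then have v: "v \<noteq> 0" and nc: "u \<noteq> c *\<^sub>R v" for c by auto
    have uv: "u \<noteq> v" using nc[of 1] by simp
    have ind: "independent {u, v}"
      using v nc uv by (auto simp: independent_insert span_singleton)
    \<comment> \<open>\<open>?w\<close> is, up to the factor \<open>G x v v\<close>, the component of \<open>u\<close> orthogonal to \<open>v\<close>; that it is nonzero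
      makes the denominator of the sectional curvature positive.\<close>
    let ?w = "G x v v *\<^sub>R u - G x u v *\<^sub>R v"
    have vv: "G x v v > 0" using metric_pos[OF assms(1) v] .
    have "?w \<noteq> 0"
    proof
      assume "?w = 0"
      then have "G x v v *\<^sub>R u = G x u v *\<^sub>R v" by simp
      then have "u = (G x u v / G x v v) *\<^sub>R v"
        using vv by (metis (no_types, lifting) divide_inverse_commute less_irrefl scaleR_scaleR scaleR_one left_inverse)
      with nc show False by blast
    qed
    then have "0 < G x ?w ?w" by (rule metric_pos[OF assms(1)])
    also have "G x ?w ?w = G x v v * (G x u u * G x v v - (G x u v)\<^sup>2)"
      by (simp add: ms metric_sym[OF assms(1), of v u] power2_eq_square algebra_simps)
    finally have "G x u u * G x v v - (G x u v)\<^sup>2 > 0"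
      using vv by (simp add: zero_less_mult_iff)
    moreover have "G x (curvature G x u v v) u / (G x u u * G x v v - (G x u v)\<^sup>2) = K"
      using K[OF uv ind] by (simp add: sectional_curvature_def)
    ultimately have "G x (curvature G x u v v) u = K * (G x u u * G x v v - (G x u v)\<^sup>2)"
      by (simp add: field_simps)
    then show ?thesis
      by (simp add: T_def metric_sym[OF assms(1), of v u] power2_eq_square algebra_simps)
  qed
  have skew34: "G x (curvature G x u v w) z = - G x (curvature G x u v z) w" for u v w z
    using curvature_metric_skew[OF assms(1), of u v "w + z"] curvature_metric_skew[OF assms(1), of u v w]
      curvature_metric_skew[OF assms(1), of u v z]
    by (simp add: linear_add[OF curvature_linear(3)[OF assms(1)]] ms)
  have "T u v w z = 0" for z
  proof (rule curvature_like_eq_zero[where T = T])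
    show "T (a + b) v w z = T a v w z + T b v w z" for a b v w z
      by (simp add: T_def linear_add[OF curvature_linear(1)[OF assms(1)]] ms algebra_simps)
    show "T u (a + b) w z = T u a w z + T u b w z" for u a b w z
      by (simp add: T_def linear_add[OF curvature_linear(2)[OF assms(1)]] ms algebra_simps)
    show "T u v (a + b) z = T u v a z + T u v b z" for u v a b z
      by (simp add: T_def linear_add[OF curvature_linear(3)[OF assms(1)]] ms algebra_simps)
    show "T u v w (a + b) = T u v w a + T u v w b" for u v w a b
      by (simp add: T_def ms algebra_simps)
    show "T u v w z = - T v u w z" for u v w z
      using curvature_skew[OF assms(1), of u v w] by (simp add: T_def ms algebra_simps)
    show "T u v w z = - T u v z w" for u v w z
      using skew34[of u v w z] by (simp add: T_def algebra_simps)
    show "T u v w z + T v w u z + T w u v z = 0" for u v w z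
    proof -
      have "G x (curvature G x u v w + curvature G x v w u + curvature G x w u v) z = 0"
        by (simp only: curvature_bianchi[OF assms(1)] ms)
      then show ?thesis
        using metric_sym[OF assms(1), of u v] metric_sym[OF assms(1), of v w] metric_sym[OF assms(1), of u w]
        by (simp add: T_def ms algebra_simps)
    qed
  qed (rule sec)
  then show ?thesis
    by (intro metric_nondegenerate[OF assms(1)]) (simp add: T_def ms)
qed

end

section \<open>Smoothness of covariant derivatives\<close>

lemma smooth_on_subset: "smooth_on T f \<Longrightarrow> S \<subseteq> T \<Longrightarrow> smooth_on S f"
  unfolding smooth_on_def using Ck_on_subset by blast

lemma smooth_on_differentiable: "smooth_on S f \<Longrightarrow> x \<in> S \<Longrightarrow> f differentiable at x"
  unfolding smooth_on_def by (metis Ck_on.simps(2))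

lemma smooth_on_fderiv_apply:
  fixes V :: "'a::euclidean_space \<Rightarrow> 'b::real_normed_vector"
  assumes "open W" "smooth_on W V" "smooth_on W X"
  shows "smooth_on W (\<lambda>x. fderiv V x (X x))"
  unfolding smooth_on_def
proof
  fix k
  show "Ck_on k W (\<lambda>x. fderiv V x (X x))"
  proof (rule Ck_on_linear_apply[where L = "fderiv V", OF assms(1)])
    show "linear (fderiv V x)" if "x \<in> W" for x
      by (rule linear_frechet_derivative[OF smooth_on_differentiable[OF assms(2) that]])
    have "Ck_on (Suc k) W V" using assms(2) by (simp only: smooth_on_def)
    then show "Ck_on k W (\<lambda>x. fderiv V x u)" for u by simp
    show "Ck_on k W X" using assms(3) by (simp only: smooth_on_def)
  qed
qed

lemma smooth_on_add: "open W \<Longrightarrow> smooth_on W f \<Longrightarrow> smooth_on W g \<Longrightarrow> smooth_on W (\<lambda>x. f x + g x)"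
  unfolding smooth_on_def using Ck_on_add by blast

lemma smooth_on_diff:
  assumes "open W" "smooth_on W f" "smooth_on W g"
  shows "smooth_on W (\<lambda>x. f x - g x)"
proof -
  have "smooth_on W (\<lambda>x. - g x)"
    using assms(3) Ck_on_bounded_linear[OF assms(1) bounded_linear_minus[OF bounded_linear_ident]]
    unfolding smooth_on_def by blast
  from smooth_on_add[OF assms(1,2) this] show ?thesis by simp
qed

lemma smooth_on_sum:
  assumes "open W" "\<And>i. i \<in> I \<Longrightarrow> smooth_on W (f i)"
  shows "smooth_on W (\<lambda>x. \<Sum>i\<in>I. f i x)"
  unfolding smooth_on_def
  by (intro allI Ck_on_sum[OF assms(1)]) (use assms(2) in \<open>simp add: smooth_on_def\<close>)

lemma smooth_on_ident: "open W \<Longrightarrow> smooth_on W (\<lambda>x. x)"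
  unfolding smooth_on_def
proof
  fix k assume W: "open W"
  show "Ck_on k W (\<lambda>x. x)"
  proof (cases k)
    case (Suc j)
    show ?thesis
      unfolding Suc by (rule Ck_on_SucI[OF W has_derivative_ident Ck_on_const])
  qed simp
qed

context chart_metric
begin

lemma smooth_on_christoffel_apply:
  fixes F :: "'a::euclidean_space \<Rightarrow> 'e"
  assumes "open W" "F ` W \<subseteq> S" "smooth_on W F" "smooth_on W U" "smooth_on W V"
  shows "smooth_on W (\<lambda>x. \<Gamma> (F x) (U x) (V x))"
  unfolding smooth_on_def
proof
  fix k
  show "Ck_on k W (\<lambda>x. \<Gamma> (F x) (U x) (V x))"
  proof (rule Ck_on_bilinear_apply[where B = "\<lambda>x. \<Gamma> (F x)", OF assms(1)])
    show "bilinear (\<Gamma> (F x))" if "x \<in> W" for x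
      using christoffel_bilinear assms(2) that by blast
    have "Ck_on k W F" using assms(3) by (simp only: smooth_on_def)
    then show "Ck_on k W (\<lambda>x. \<Gamma> (F x) u v)" for u v
      by (rule Ck_on_compose[where f = "\<lambda>y. \<Gamma> y u v", OF assms(1) open_S Ck_christoffel _ assms(2)])
  qed (use assms(4,5) in \<open>simp_all only: smooth_on_def\<close>)
qed

lemma smooth_on_nabla_pull:
  fixes F :: "'a::euclidean_space \<Rightarrow> 'e"
  assumes "open W" "F ` W \<subseteq> S" "smooth_on W F" "smooth_on W X" "smooth_on W V"
  shows "smooth_on W (nabla_pull G F X V)"
proof -
  have "smooth_on W (\<lambda>x. fderiv V x (X x) + \<Gamma> (F x) (fderiv F x (X x)) (V x))"
    by (rule smooth_on_add[OF assms(1) smooth_on_fderiv_apply[OF assms(1,5,4)]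
        smooth_on_christoffel_apply[OF assms(1-3) smooth_on_fderiv_apply[OF assms(1,3,4)] assms(5)]])
  moreover have "nabla_pull G F X V = (\<lambda>x. fderiv V x (X x) + \<Gamma> (F x) (fderiv F x (X x)) (V x))"
    by (rule ext) (simp add: nabla_pull_def push_def)
  ultimately show ?thesis by simp
qed

lemma smooth_on_nabla:
  assumes "smooth_on S X" "smooth_on S Y"
  shows "smooth_on S (nabla G X Y)"
proof -
  have "nabla G X Y = nabla_pull G (\<lambda>x. x) X Y"
    by (rule ext) (simp add: nabla_def nabla_pull_def push_def)
  moreover have "smooth_on S (nabla_pull G (\<lambda>x. x) X Y)"
    by (rule smooth_on_nabla_pull[OF open_S _ smooth_on_ident[OF open_S] assms]) simp
  ultimately show ?thesis by simp
qed

text \<open>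
  Covariant derivatives are local, and commute with constant factors where the section is
  differentiable.
\<close>

lemma nabla_pull_scaleR:
  fixes F :: "'a::euclidean_space \<Rightarrow> 'e"
  assumes "open W" "x \<in> W" "F x \<in> S" "V differentiable at x" "\<And>z. z \<in> W \<Longrightarrow> V' z = c *\<^sub>R V z"
  shows "nabla_pull G F X V' x = c *\<^sub>R nabla_pull G F X V x"
proof -
  have "((\<lambda>z. c *\<^sub>R V z) has_derivative (\<lambda>h. c *\<^sub>R fderiv V x h)) (at x)"
    by (intro has_derivative_scaleR_right has_derivative_fderiv assms(4))
  then have "(V' has_derivative (\<lambda>h. c *\<^sub>R fderiv V x h)) (at x)"
    by (rule has_derivative_transform_within_open[OF _ assms(1,2)]) (simp add: assms(5))
  then show ?thesis
    by (simp add: nabla_pull_def fderiv_eq assms(5)[OF assms(2)] scaleR_add_right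
        linear_scale[OF christoffel_linear(1)[OF assms(3)]])
qed

end

section \<open>Isometric immersions in a pair of charts\<close>

text \<open>
  An isometric immersion \<open>F\<close> of a chart \<open>(W, G)\<close> into a chart \<open>(S, H)\<close>, together with an
  orthonormal frame on \<open>W\<close>.
\<close>

locale immersed_chart =
  source: chart_metric W G + target: chart_metric S H
  for W :: "'e::euclidean_space set" and G and S :: "'f::euclidean_space set" and H +
  fixes F :: "'e \<Rightarrow> 'f" and e :: "nat \<Rightarrow> 'e \<Rightarrow> 'e"
  assumes smooth_F: "smooth_on W F" and image_F: "F ` W \<subseteq> S"
    and isometric: "x \<in> W \<Longrightarrow> G x u v = H (F x) (fderiv F x u) (fderiv F x v)"
    and frame: "orthonormal_frame G W e"
begin

lemma F_in: "x \<in> W \<Longrightarrow> F x \<in> S"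
  using image_F by auto

lemma F_differentiable: "x \<in> W \<Longrightarrow> F differentiable at x"
  by (rule smooth_on_differentiable[OF smooth_F])

lemma F_linear: "x \<in> W \<Longrightarrow> linear (fderiv F x)"
  by (rule linear_frechet_derivative[OF F_differentiable])

lemma smooth_e: "i < DIM('e) \<Longrightarrow> smooth_on W (e i)"
  using frame by (simp add: orthonormal_frame_def)

lemma frame_metric:
  "x \<in> W \<Longrightarrow> i < DIM('e) \<Longrightarrow> j < DIM('e) \<Longrightarrow>
     H (F x) (push F (e i) x) (push F (e j) x) = (if i = j then 1 else 0)"
  using frame isometric by (simp add: orthonormal_frame_def push_def)

text \<open>
  The covariant derivative of \<open>dF\<close>: the value at \<open>x\<close> of \<open>\<nabla>\<^sub>u(dF v) - dF(\<nabla>\<^sub>u v)\<close> for fields \<open>u\<close>, \<open>v\<close> that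
  are constant in the chart.
\<close>

definition second_fundamental_form :: "'e \<Rightarrow> 'e \<Rightarrow> 'e \<Rightarrow> 'f" where
  "second_fundamental_form x u v = fderiv (\<lambda>z. fderiv F z v) x u
     + christoffel H (F x) (fderiv F x u) (fderiv F x v) - fderiv F x (christoffel G x u v)"

lemma dF_differentiable: "x \<in> W \<Longrightarrow> (\<lambda>z. fderiv F z v) differentiable at x"
proof -
  have "Ck_on 2 W F" using smooth_F by (simp only: smooth_on_def)
  then show "x \<in> W \<Longrightarrow> ?thesis" by (simp add: numeral_2_eq_2)
qed

text \<open>
  The tangential part of \<open>\<nabla>\<^sub>u(dF v)\<close> is \<open>dF(\<nabla>\<^sub>u v)\<close>.  The form is symmetric in \<open>u\<close>, \<open>v\<close>; and since \<open>G\<close> is the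
  pull-back of \<open>H\<close>, comparing the derivatives of \<open>G v w\<close> and \<open>H (dF v) (dF w)\<close> shows that its
  tangential part is skew in \<open>v\<close>, \<open>w\<close>.
\<close>

lemma second_fundamental_form_normal:
  assumes "x \<in> W"
  shows "H (F x) (second_fundamental_form x u v) (fderiv F x w) = 0"
proof (rule sym_skew_imp_zero[of "\<lambda>u v w. H (F x) (second_fundamental_form x u v) (fderiv F x w)"])
  fix u v w
  have "Ck_on 2 W F" using smooth_F by (simp only: smooth_on_def)
  from second_derivative_symmetric[OF source.open_S assms this, of v u]
  have "second_fundamental_form x u v = second_fundamental_form x v u"
    by (simp add: second_fundamental_form_def source.christoffel_sym[OF assms, of u v]
        target.christoffel_sym[OF F_in[OF assms], of "fderiv F x u"])
  then show "H (F x) (second_fundamental_form x u v) (fderiv F x w)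
      = H (F x) (second_fundamental_form x v u) (fderiv F x w)" by simp
  let ?D = "\<lambda>v. nabla_pull H F (\<lambda>_. u) (\<lambda>z. fderiv F z v) x"
  have D: "?D v = second_fundamental_form x u v + fderiv F x (christoffel G x u v)" for v
    by (simp add: second_fundamental_form_def nabla_pull_def push_def)
  have "source.dG x u v w = fderiv (\<lambda>z. H (F z) (fderiv F z v) (fderiv F z w)) x u"
    by (subst fderiv_cong_open[OF source.open_S assms isometric source.metric_differentiable[OF assms]])
      simp_all
  also have "\<dots> = H (F x) (?D v) (fderiv F x w) + H (F x) (fderiv F x v) (?D w)"
    by (rule target.nabla_pull_metric[OF source.open_S assms image_F F_differentiable[OF assms]
          dF_differentiable[OF assms] dF_differentiable[OF assms]])
  also have "source.dG x u v w = G x (christoffel G x u v) w + G x v (christoffel G x u w)"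
    by (rule source.christoffel_compatible[OF assms])
  finally show "H (F x) (second_fundamental_form x u v) (fderiv F x w)
      = - H (F x) (second_fundamental_form x u w) (fderiv F x v)"
    by (simp add: D isometric[OF assms] target.metric_simps[OF F_in[OF assms]]
        target.metric_sym[OF F_in[OF assms], of "fderiv F x v"])
qed

abbreviation \<tau> :: "'e \<Rightarrow> 'f" where "\<tau> \<equiv> tension G H F e"

text \<open>The induced covariant derivative in the direction of the \<open>i\<close>-th frame field.\<close>

abbreviation cov :: "nat \<Rightarrow> ('e \<Rightarrow> 'f) \<Rightarrow> 'e \<Rightarrow> 'f" where
  "cov i \<equiv> nabla_pull H F (e i)"

lemma smooth_cov: "i < DIM('e) \<Longrightarrow> smooth_on W V \<Longrightarrow> smooth_on W (cov i V)"
  by (rule target.smooth_on_nabla_pull[OF source.open_S image_F smooth_F smooth_e])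

lemma smooth_push: "smooth_on W X \<Longrightarrow> smooth_on W (push F X)"
  using smooth_on_fderiv_apply[OF source.open_S smooth_F, of X]
  by (simp add: push_def[abs_def])

lemma smooth_tension: "smooth_on W \<tau>"
proof -
  have "smooth_on W (\<lambda>x. \<Sum>i<DIM('e). cov i (push F (e i)) x - push F (nabla G (e i) (e i)) x)"
    by (intro smooth_on_sum[OF source.open_S] smooth_on_diff[OF source.open_S] smooth_cov
        smooth_push source.smooth_on_nabla smooth_e) simp_all
  then show ?thesis by (simp add: tension_def[abs_def])
qed

lemma tension_eq:
  assumes "x \<in> W"
  shows "\<tau> x = (\<Sum>i<DIM('e). second_fundamental_form x (e i x) (e i x))"
  unfolding tension_def
proof (rule sum.cong[OF refl])
  fix i assume "i \<in> {..<DIM('e)}"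
  then have e: "e i differentiable at x"
    using smooth_on_differentiable[OF smooth_e assms] by simp
  have "((\<lambda>y. fderiv F y (e i y)) has_derivative
      (\<lambda>h. fderiv (\<lambda>y. fderiv F y (e i x)) x h + fderiv F x (fderiv (e i) x h))) (at x)"
    by (rule has_derivative_linear_apply[where L = "fderiv F", OF source.open_S assms F_linear
          dF_differentiable[OF assms] e])
  from fderiv_eq[OF this, of "e i x"]
  show "cov i (push F (e i)) x - push F (nabla G (e i) (e i)) x
      = second_fundamental_form x (e i x) (e i x)"
    by (simp add: nabla_pull_def nabla_def push_def[abs_def] second_fundamental_form_def
        linear_add[OF F_linear[OF assms]])
qed

lemma tension_normal:
  assumes "x \<in> W"
  shows "H (F x) (\<tau> x) (fderiv F x w) = 0"
  unfolding tension_eq[OF assms]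
  by (simp add: linear_sum[OF target.metric_linear(2)[OF F_in[OF assms]]]
      second_fundamental_form_normal[OF assms])

lemma sum_cov_tension_tangential:
  assumes "x \<in> W"
  shows "(\<Sum>i<DIM('e). H (F x) (cov i \<tau> x) (push F (e i) x)) = - H (F x) (\<tau> x) (\<tau> x)"
proof -
  note S = F_in[OF assms]
  have n: "H (F x) (\<tau> x) (push F X x) = 0" for X
    by (simp add: push_def tension_normal[OF assms])
  have "H (F x) (cov i \<tau> x) (push F (e i) x)
      = - H (F x) (\<tau> x) (cov i (push F (e i)) x - push F (nabla G (e i) (e i)) x)"
    if i: "i < DIM('e)" for i
  proof -
    have "H (F x) (cov i \<tau> x) (push F (e i) x) + H (F x) (\<tau> x) (cov i (push F (e i)) x)
        = fderiv (\<lambda>z. H (F z) (\<tau> z) (push F (e i) z)) x (e i x)"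
      by (rule target.nabla_pull_metric[symmetric, OF source.open_S assms image_F
            F_differentiable[OF assms] smooth_on_differentiable[OF smooth_tension assms]
            smooth_on_differentiable[OF smooth_push[OF smooth_e[OF i]] assms]])
    also have "fderiv (\<lambda>z. H (F z) (\<tau> z) (push F (e i) z)) x = fderiv (\<lambda>z. 0) x"
      by (rule fderiv_cong_open[OF source.open_S assms]) (simp_all add: tension_normal push_def)
    finally show ?thesis
      by (simp add: target.metric_simps[OF S] n)
  qed
  then have "(\<Sum>i<DIM('e). H (F x) (cov i \<tau> x) (push F (e i) x))
      = - (\<Sum>i<DIM('e). H (F x) (\<tau> x) (cov i (push F (e i)) x - push F (nabla G (e i) (e i)) x))"
    by (simp add: sum_negf)
  also have "\<dots> = - H (F x) (\<tau> x) (\<tau> x)"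
    by (simp add: linear_sum[OF target.metric_linear(1)[OF S], symmetric] tension_def)
  finally show ?thesis .
qed

lemma rough_laplacian_scaleR:
  assumes "smooth_on W V" "\<And>z. z \<in> W \<Longrightarrow> V' z = c *\<^sub>R V z" "x \<in> W"
  shows "rough_laplacian G H F e V' x = c *\<^sub>R rough_laplacian G H F e V x"
proof -
  have *: "nabla_pull H F X V' z = c *\<^sub>R nabla_pull H F X V z" if "z \<in> W" for z X
    by (rule target.nabla_pull_scaleR[where F = F and V = V and V' = V' and c = c, OF source.open_S that F_in[OF that]
          smooth_on_differentiable[OF assms(1) that] assms(2)])
  have "cov i (cov i V') x = c *\<^sub>R cov i (cov i V) x" if "i < DIM('e)" for i
    by (rule target.nabla_pull_scaleR[where F = F and V = "cov i V" and V' = "cov i V'" and c = c, OF source.open_S assms(3) F_in[OF assms(3)]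
          smooth_on_differentiable[OF smooth_cov[OF that assms(1)] assms(3)] *])
  then show ?thesis
    by (simp add: rough_laplacian_def *[OF assms(3)] scaleR_diff_right[symmetric]
        scaleR_sum_right[symmetric])
qed

end

section \<open>Biharmonic immersions into spaces of constant curvature\<close>

text \<open>
  A biharmonic isometric immersion into a chart of constant curvature \<open>K\<close>; \<open>\<kappa>\<close> is the eigenvalue of
  the rough Laplacian on the tension field.
\<close>

locale constant_curvature_biharmonic_chart = immersed_chart W G S H F e
  for W :: "'e::euclidean_space set" and G and S :: "'f::euclidean_space set" and H F e +
  fixes K \<kappa> :: real
  assumes kappa: "\<kappa> = K * real DIM('e)"
    and curvature_H: "y \<in> S \<Longrightarrow> curvature H y u v w = K *\<^sub>R (H y v w *\<^sub>R u - H y u w *\<^sub>R v)"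
    and biharmonic: "x \<in> W \<Longrightarrow> bitension G H F e x = 0"
begin

lemma sum_curvature_tension:
  assumes "x \<in> W"
  shows "(\<Sum>i<DIM('e). curvature H (F x) (c *\<^sub>R \<tau> x) (push F (e i) x) (push F (e i) x)) = (\<kappa> * c) *\<^sub>R \<tau> x"
proof -
  have "curvature H (F x) (c *\<^sub>R \<tau> x) (push F (e i) x) (push F (e i) x) = (K * c) *\<^sub>R \<tau> x"
    if "i < DIM('e)" for i
    using tension_normal[OF assms] frame_metric[OF assms that that]
    by (simp add: curvature_H[OF F_in[OF assms]] push_def target.metric_simps[OF F_in[OF assms]])
  then show ?thesis by (simp add: sum_constant_scaleR kappa mult_ac)
qed

lemma rough_laplacian_tension:
  assumes "x \<in> W"
  shows "rough_laplacian G H F e \<tau> x = \<kappa> *\<^sub>R \<tau> x"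
  using biharmonic[OF assms] sum_curvature_tension[OF assms, of 1] by (simp add: bitension_def)

lemma lap_tension_eq: "x \<in> W \<Longrightarrow> lap_tension G H F e k x = \<kappa> ^ k *\<^sub>R \<tau> x"
proof (induction k arbitrary: x)
  case 0
  then show ?case by (simp add: lap_tension_def)
next
  case (Suc k)
  have "lap_tension G H F e (Suc k) x = rough_laplacian G H F e (lap_tension G H F e k) x"
    by (simp add: lap_tension_def)
  also have "\<dots> = \<kappa> ^ k *\<^sub>R rough_laplacian G H F e \<tau> x"
    by (rule rough_laplacian_scaleR[OF smooth_tension Suc.IH Suc.prems])
  finally show ?case by (simp add: rough_laplacian_tension[OF Suc.prems])
qed

lemma cov_lap_tension: "x \<in> W \<Longrightarrow> cov j (lap_tension G H F e k) x = \<kappa> ^ k *\<^sub>R cov j \<tau> x"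
  by (rule target.nabla_pull_scaleR[where F = F and V' = "lap_tension G H F e k", OF source.open_S _ F_in smooth_on_differentiable[OF smooth_tension]
        lap_tension_eq])

lemma sum_curvature_cov_tension:
  assumes "x \<in> W"
  shows "(\<Sum>j<DIM('e). curvature H (F x) (a *\<^sub>R cov j \<tau> x) (b *\<^sub>R \<tau> x) (push F (e j) x))
      = (a * b * K * H (F x) (\<tau> x) (\<tau> x)) *\<^sub>R \<tau> x"
    and "(\<Sum>j<DIM('e). curvature H (F x) (a *\<^sub>R \<tau> x) (b *\<^sub>R cov j \<tau> x) (push F (e j) x))
      = - ((a * b * K * H (F x) (\<tau> x) (\<tau> x)) *\<^sub>R \<tau> x)"
proof -
  note S = F_in[OF assms]
  have "curvature H (F x) (a *\<^sub>R cov j \<tau> x) (b *\<^sub>R \<tau> x) (push F (e j) x)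
      = (- (a * b * K) * H (F x) (cov j \<tau> x) (push F (e j) x)) *\<^sub>R \<tau> x" for j a b
    using tension_normal[OF assms]
    by (simp add: curvature_H[OF S] push_def target.metric_simps[OF S] mult_ac)
  then have 1: "(\<Sum>j<DIM('e). curvature H (F x) (a *\<^sub>R cov j \<tau> x) (b *\<^sub>R \<tau> x) (push F (e j) x))
      = (a * b * K * H (F x) (\<tau> x) (\<tau> x)) *\<^sub>R \<tau> x" for a b
    by (simp only: scaleR_sum_left[symmetric] sum_distrib_left[symmetric]
        sum_negf sum_cov_tension_tangential[OF assms] mult_minus_left mult_minus_right minus_minus)
  show "(\<Sum>j<DIM('e). curvature H (F x) (a *\<^sub>R cov j \<tau> x) (b *\<^sub>R \<tau> x) (push F (e j) x))
      = (a * b * K * H (F x) (\<tau> x) (\<tau> x)) *\<^sub>R \<tau> x"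
    by (rule 1)
  have "(\<Sum>j<DIM('e). curvature H (F x) (a *\<^sub>R \<tau> x) (b *\<^sub>R cov j \<tau> x) (push F (e j) x))
      = (\<Sum>j<DIM('e). - curvature H (F x) (b *\<^sub>R cov j \<tau> x) (a *\<^sub>R \<tau> x) (push F (e j) x))"
    by (intro sum.cong refl target.curvature_skew[OF S])
  also have "\<dots> = - ((a * b * K * H (F x) (\<tau> x) (\<tau> x)) *\<^sub>R \<tau> x)"
    by (simp add: sum_negf 1 mult.commute[of b])
  finally show "(\<Sum>j<DIM('e). curvature H (F x) (a *\<^sub>R \<tau> x) (b *\<^sub>R cov j \<tau> x) (push F (e j) x))
      = - ((a * b * K * H (F x) (\<tau> x) (\<tau> x)) *\<^sub>R \<tau> x)" .
qed

text \<open>The equation of \<open>(2s + 1)\<close>-harmonicity reduces to the vanishing of \<open>|\<tau>|\<^sup>2 \<tau>\<close>.\<close>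

lemma odd_polytension_eq:
  assumes "x \<in> W" "s \<ge> 1"
  shows "odd_polytension s G H F e x
    = - ((real (2 * s - 1) * \<kappa> ^ (2 * s - 2) * K * H (F x) (\<tau> x) (\<tau> x)) *\<^sub>R \<tau> x)"
proof -
  let ?T = "lap_tension G H F e" and ?R = "curvature H (F x)" and ?f = "\<lambda>j. push F (e j) x"
  define A where "A = \<kappa> ^ (2 * s - 2) * K * H (F x) (\<tau> x) (\<tau> x)"
  note T = lap_tension_eq[OF assms(1)] and N = cov_lap_tension[OF assms(1)]
  have 1: "(\<Sum>j<DIM('e). ?R (?T (2 * s - 1) x) (?f j) (?f j)) = ?T (2 * s) x"
  proof -
    have "\<kappa> * \<kappa> ^ (2 * s - 1) = \<kappa> ^ (2 * s)"
      using assms(2) by (simp flip: power_Suc)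
    then show ?thesis unfolding T sum_curvature_tension[OF assms(1)] by simp
  qed
  have 2: "(\<Sum>j<DIM('e). ?R (cov j (?T (s + l - 1)) x) (?T (s - l - 1) x) (?f j)
             - ?R (?T (s + l - 1) x) (cov j (?T (s - l - 1)) x) (?f j)) = (2 * A) *\<^sub>R \<tau> x"
    if "l \<in> {1..s - 1}" for l
  proof -
    have "(s + l - 1) + (s - l - 1) = 2 * s - 2" using that by auto
    then have "\<kappa> ^ (s + l - 1) * \<kappa> ^ (s - l - 1) = \<kappa> ^ (2 * s - 2)"
      by (simp only: power_add[symmetric])
    then show ?thesis
      unfolding T N sum_subtractf sum_curvature_cov_tension[OF assms(1)]
      by (simp add: A_def scaleR_add_left[symmetric])
  qed
  have 3: "(\<Sum>i<DIM('e). ?R (cov i (?T (s - 1)) x) (?T (s - 1) x) (?f i)) = A *\<^sub>R \<tau> x"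
  proof -
    have "(s - 1) + (s - 1) = 2 * s - 2" using assms(2) by auto
    then have "\<kappa> ^ (s - 1) * \<kappa> ^ (s - 1) = \<kappa> ^ (2 * s - 2)"
      by (simp only: power_add[symmetric])
    then show ?thesis
      unfolding T N sum_curvature_cov_tension[OF assms(1)] by (simp add: A_def)
  qed
  have "odd_polytension s G H F e x
      = - (\<Sum>l = 1..s - 1. (2 * A) *\<^sub>R \<tau> x) - A *\<^sub>R \<tau> x"
    unfolding odd_polytension_def Let_def 1 3 using 2 by simp
  also have "\<dots> = - ((real (2 * s - 1) * A) *\<^sub>R \<tau> x)"
  proof -
    have "real (2 * s - 1) * A = real (s - 1) * (2 * A) + A"
      using assms(2) by (simp add: of_nat_diff algebra_simps)
    then show ?thesis by (simp add: sum_constant_scaleR scaleR_add_left)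
  qed
  finally show ?thesis by (simp add: A_def mult.assoc)
qed

lemma odd_polyharmonic_imp_harmonic:
  assumes "K \<noteq> 0" "s \<ge> 1" "x \<in> W" "odd_polytension s G H F e x = 0"
  shows "\<tau> x = 0"
proof (rule ccontr)
  assume "\<tau> x \<noteq> 0"
  then have "H (F x) (\<tau> x) (\<tau> x) > 0"
    by (rule target.metric_pos[OF F_in[OF assms(3)]])
  moreover have "real (2 * s - 1) \<noteq> 0" "\<kappa> \<noteq> 0" using assms(1,2) by (auto simp: kappa)
  ultimately show False
    using odd_polytension_eq[OF assms(3,2)] assms(1,4) \<open>\<tau> x \<noteq> 0\<close> by simp
qed

end

section \<open>From charts to manifolds\<close>

text \<open>
  Injectivity of the chart is needed for the second inclusion: it says that the coordinate map
  evaluates \<open>\<phi>\<close> at the intended point.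
\<close>

lemma coord_map_image:
  assumes "chart_on X c"
  shows "coord_dom c d \<phi> \<subseteq> coord_image c" "coord_map c d \<phi> ` coord_dom c d \<phi> \<subseteq> coord_image d"
proof -
  show "coord_dom c d \<phi> \<subseteq> coord_image c"
    by (auto simp: coord_dom_def coord_image_def)
  have "fst c \<subseteq> topspace X"
    using assms by (simp add: chart_on_def openin_subset)
  moreover have "inj_on (snd c) (topspace (subtopology X (fst c)))"
    using assms unfolding chart_on_def by (blast intro: homeomorphic_imp_injective_map)
  ultimately have inj: "inj_on (snd c) (fst c)"
    by (simp add: Int_absorb1)
  show "coord_map c d \<phi> ` coord_dom c d \<phi> \<subseteq> coord_image d"
    using inv_into_f_f[OF inj]
    by (auto simp: coord_map_def coord_dom_def coord_image_def chart_inv_def)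
qed

lemma local_metric_subset: "local_metric S G \<Longrightarrow> W \<subseteq> S \<Longrightarrow> local_metric W G"
  unfolding local_metric_def using smooth_on_subset by blast

theorem theorem3p5:
  fixes M :: "('p, 'e::euclidean_space) riemannian"
    and N :: "('q, 'f::euclidean_space) riemannian"
    and \<phi> :: "'p \<Rightarrow> 'q" and K :: real and s :: nat
  assumes "riemannian_manifold M"
    and "riemannian_manifold N"
    and "constant_sectional_curvature N K" and "K \<noteq> 0"
    and "isometric_immersion M N \<phi>"
    and "biharmonic M N \<phi>"
    and "s \<ge> 1"
    and "odd_polyharmonic s M N \<phi>"
  shows "harmonic M N \<phi>"
  unfolding harmonic_def vanishes_in_frames_def
proof (intro ballI allI impI, elim conjE)
  fix c d W e x
  assume c: "c \<in> atlas M" and d: "d \<in> atlas N" and x: "x \<in> W"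
    and W: "open W" "W \<subseteq> coord_dom c d \<phi>" and e: "orthonormal_frame (metric M c) W e"
  let ?G = "metric M c" and ?H = "metric N d" and ?F = "coord_map c d \<phi>"
  have charts: "chart_on (base M) c" "chart_on (base N) d"
    using assms(1,2) c d by (auto simp: riemannian_manifold_def smooth_manifold_def)
  note image = coord_map_image[OF charts(1), of d \<phi>]
  have H: "local_metric (coord_image d) ?H"
    using assms(2) d by (simp add: riemannian_manifold_def)
  have "local_metric (coord_image c) ?G"
    using assms(1) c by (simp add: riemannian_manifold_def)
  then have G: "local_metric W ?G"
    by (rule local_metric_subset) (use W(2) image(1) in blast)
  interpret target: chart_metric "coord_image d" ?H
    using charts(2) H by unfold_locales (simp add: chart_on_def)
  interpret constant_curvature_biharmonic_chart W ?G "coord_image d" ?H ?F e K "K * real DIM('e)"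
  proof unfold_locales
    show "smooth_on W ?F"
      using assms(5) c d W(2) by (auto simp: isometric_immersion_def smooth_map_def intro: smooth_on_subset)
    show "?F ` W \<subseteq> coord_image d" using image(2) W(2) by blast
    show "?G x u v = ?H (?F x) (fderiv ?F x u) (fderiv ?F x v)" if "x \<in> W" for x u v
      using assms(5) c d W(2) that unfolding isometric_immersion_def by blast
    show "curvature ?H x u v w = K *\<^sub>R (?H x v w *\<^sub>R u - ?H x u w *\<^sub>R v)"
      if "x \<in> coord_image d" for x u v w
      using assms(3) d that
      by (intro target.constant_curvature_eq) (auto simp: constant_sectional_curvature_def)
    show "bitension ?G ?H ?F e x = 0" if "x \<in> W" for x
      using assms(6) c d W e that unfolding biharmonic_def vanishes_in_frames_def by blast
  qed (use W(1) G e in auto)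
  have "odd_polytension s ?G ?H ?F e x = 0"
    using assms(8) c d W e x unfolding odd_polyharmonic_def vanishes_in_frames_def by blast
  then show "tension ?G ?H ?F e x = 0"
    by (rule odd_polyharmonic_imp_harmonic[OF assms(4,7) x])
qed

end
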